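(* Let $c_3 = \sqrt[64]{2\,\theta(64)}$, where $\theta(64) = 39911512393313043466768$ (so $c_3 = 2.279\ldots$). Then for all integers $k \geq 6$ and $n = 2^k$, \[ \theta(n) \geq \frac{c_3^n}{2}. \]
   Context: For a positive integer $n$, let $[n]=\{1,2,\ldots,n\}$. A permutation $(a_1,a_2,\ldots,a_n)$ of $[n]$ is called 3-free if there do not exist indices $i<j<k$ with $a_i + a_k = 2a_j$, i.e., it contains no 3-term arithmetic progression as a subsequence. $\theta(n)$ denotes the number of 3-free permutations of $[n]$. *)

theory Defs
  imports Complex_Main "HOL-Combinatorics.Multiset_Permutations"
begin

definition three_free :: "nat list \<Rightarrow> bool" where
  "three_free a \<longleftrightarrow>
     \<not> (\<exists>i j k. i < j \<and> j < k \<and> k < length a \<and> a ! i + a ! k = 2 * a ! j)"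

definition theta :: "nat \<Rightarrow> nat" where
  "theta n = card {a \<in> permutations_of_set {1..n}. three_free a}"

definition c3 :: real where
  "c3 = root 64 (2 * real (theta 64))"

end

theory Submission
  imports Defs "HOL-Library.Sublist"
begin

text \<open>
  The key fact is that for an odd \<open>d\<close> and \<open>1 \<le> y - d\<close>, \<open>y + d \<le> n\<close>, the relative order of \<open>y\<close> and
  \<open>y \<plusminus> d\<close> in a 3-free permutation of \<open>[n]\<close> is the same as that of \<open>y\<close> and \<open>y + 1\<close>. Hence a 3-free
  permutation of \<open>[2m]\<close> is a shuffle of two 3-free permutations of \<open>[m]\<close> (its even and its odd
  entries) in which, say, the evens go first: an even and an odd number must appear in this order
  as soon as they lie in a common 3-term progression of \<open>[2m]\<close> in which one of them is the middle
  term; all other even-odd pairs are free. Conversely every such shuffle is 3-free.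

  Applied recursively, this describes the 3-free permutations of \<open>[2^k]\<close> as the accepted words of
  a deterministic automaton without dead states. For \<open>k = 6\<close> it has only about ten thousand
  reachable states, so the accepted words can be counted layer by layer by rewriting.

  The lower bound then follows from \<open>theta (2n) \<ge> 2 (theta n)^2\<close>, obtained by listing the evens
  before the odds or vice versa.
\<close>

section \<open>Even and odd entries of a 3-free permutation\<close>

text \<open>
  For \<open>x\<close>, \<open>y\<close> in \<open>[n]\<close>: \<open>2y - x\<close> or \<open>2x - y\<close> lies in \<open>[n]\<close>.
\<close>

definition related :: "nat \<Rightarrow> nat \<Rightarrow> nat \<Rightarrow> bool" where
  "related n x y \<longleftrightarrow> (x < 2 * y \<and> 2 * y \<le> n + x) \<or> (y < 2 * x \<and> 2 * x \<le> n + y)"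

text \<open>
  If the claim fails for \<open>d\<close> but holds for \<open>d - 2\<close>, then with \<open>x = y - d\<close> both \<open>x + 2\<close> precedes \<open>x\<close> and
  \<open>x + 2(d - 1)\<close> precedes \<open>x + 2d\<close>. But the order alternates along \<open>x, x + 2, \<dots>, x + 2d\<close>.
\<close>

lemma odd_step_order_le:
  fixes p :: "nat \<Rightarrow> int"
  assumes inj: "inj_on p {1..n}"
    and sym: "\<And>y d. 0 < d \<Longrightarrow> d < y \<Longrightarrow> y + d \<le> n \<Longrightarrow> p (y - d) < p y \<longleftrightarrow> p (y + d) < p y"
  shows "odd d \<Longrightarrow> d < y \<Longrightarrow> y + d \<le> n \<Longrightarrow> p (y + 1) < p y \<Longrightarrow> p (y + d) < p y"
proof (induction d rule: less_induct)
  case (less d)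
  show ?case
  proof (cases "d = 1")
    case False
    with less.prems(1) have d: "d \<ge> 3" by presburger
    have near: "p (y + (d - 2)) < p y"
      by (rule less.IH) (use less.prems d in auto)
    with sym[of "d - 2" y] less.prems d have near': "p (y - (d - 2)) < p y" by auto
    show ?thesis
    proof (rule ccontr)
      assume far: "\<not> p (y + d) < p y"
      with sym[of d y] less.prems have far': "\<not> p (y - d) < p y" by (auto elim: oddE)
      define x where "x = y - d"
      have x: "1 \<le> x" "y = x + d" using less.prems by (auto simp: x_def)
      have alt: "k < d \<Longrightarrow> p (x + 2 * k + 2) < p (x + 2 * k) \<longleftrightarrow> even k" for k
      proof (induction k)
        case 0
        have "y - (d - 2) = x + 2" using x d by auto
        with near' far' show ?case by (auto simp: x_def)
      next
        case (Suc k)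
        have ne: "p (x + 2 * k + 2) \<noteq> p (x + 2 * k)"
          using inj_onD[OF inj, of "x + 2 * k + 2" "x + 2 * k"] Suc.prems x less.prems by auto
        have "p (x + 2 * k) < p (x + 2 * k + 2) \<longleftrightarrow> p (x + 2 * k + 2 + 2) < p (x + 2 * k + 2)"
          using sym[of 2 "x + 2 * k + 2"] Suc.prems x less.prems by simp
        moreover have "x + 2 * Suc k = x + 2 * k + 2" by simp
        ultimately show ?case using Suc.IH Suc.prems ne by (metis even_Suc linorder_neqE Suc_lessD order.asym)
      qed
      \<comment> \<open>The first and the last of the \<open>d\<close> steps both have even index
        and so run the same way: \<open>y + d\<close> comes before \<open>y + (d - 2)\<close>, hence
        before \<open>y\<close>.\<close>
      have "even (d - 1)" "d - 1 < d" using less.prems d by auto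
      with alt[of "d - 1"] have "p (x + 2 * (d - 1) + 2) < p (x + 2 * (d - 1))" by blast
      moreover have "x + 2 * (d - 1) + 2 = y + d" "x + 2 * (d - 1) = y + (d - 2)" using x d by auto
      ultimately have "p (y + d) < p (y + (d - 2))" by metis
      with near far show False by linarith
    qed
  qed (use less.prems in auto)
qed

text \<open>The converse is \<open>odd_step_order_le\<close> for the reversed permutation, since
  negated positions satisfy the same hypotheses. Positions are integers so that they can be
  negated.\<close>

lemma odd_step_order:
  fixes p :: "nat \<Rightarrow> int"
  assumes inj: "inj_on p {1..n}"
    and sym: "\<And>y d. 0 < d \<Longrightarrow> d < y \<Longrightarrow> y + d \<le> n \<Longrightarrow> p (y - d) < p y \<longleftrightarrow> p (y + d) < p y"
    and d: "odd d" "d < y" "y + d \<le> n"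
  shows "p (y + d) < p y \<longleftrightarrow> p (y + 1) < p y"
proof
  show "p (y + 1) < p y \<Longrightarrow> p (y + d) < p y"
    using odd_step_order_le[OF inj sym d] by blast
next
  assume *: "p (y + d) < p y"
  have d0: "0 < d" using d(1) by (auto elim: oddE)
  have ne: "p u \<noteq> p v" if "u \<in> {1..n}" "v \<in> {1..n}" "u \<noteq> v" for u v
    using inj that by (auto dest: inj_onD)
  show "p (y + 1) < p y"
  proof (rule ccontr)
    assume "\<not> p (y + 1) < p y"
    then have neg: "- p (y + 1) < - p y" using ne[of "y + 1" y] d d0 by force
    have neg_sym: "- p (y - e) < - p y \<longleftrightarrow> - p (y + e) < - p y" if "0 < e" "e < y" "y + e \<le> n" for y e
      using sym[OF that] ne[of "y - e" y] ne[of "y + e" y] that by (simp add: linorder_neq_iff not_less) linarith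
    have neg_inj: "inj_on (\<lambda>x. - p x) {1..n}" by (rule inj_onI) (use inj in \<open>simp add: inj_on_eq_iff\<close>)
    have "- p (y + d) < - p y"
      by (rule odd_step_order_le[OF neg_inj neg_sym d neg])
    with * show False by simp
  qed
qed

text \<open>Here \<open>h\<close> is the first entry. By \<open>sym\<close> around
  \<open>x + 1\<close>, the truth of \<open>q x\<close> (of \<open>x\<close> and
  \<open>x + 1\<close>, the one with the parity of \<open>h\<close> comes first) does not depend on
  \<open>x\<close>. A pair containing \<open>h\<close> makes it true, and
  \<open>odd_step_order\<close> carries it from neighbours to all related pairs.\<close>

lemma related_order:
  fixes p :: "nat \<Rightarrow> int"
  assumes inj: "inj_on p {1..n}"
    and sym: "\<And>y d. 0 < d \<Longrightarrow> d < y \<Longrightarrow> y + d \<le> n \<Longrightarrow> p (y - d) < p y \<longleftrightarrow> p (y + d) < p y"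
    and first: "h \<in> {1..n}" "\<And>x. x \<in> {1..n} \<Longrightarrow> x \<noteq> h \<Longrightarrow> p h < p x"
    and u: "u \<in> {1..n}" "even u \<longleftrightarrow> even h" and v: "v \<in> {1..n}" "even v \<noteq> even h"
    and rel: "related n u v"
  shows "p u < p v"
proof -
  have uv_ne: "u \<noteq> v" using u v by auto
  have n: "n \<ge> 3" using rel u(1) v(1) uv_ne unfolding related_def atLeastAtMost_iff by linarith
  have ne: "p u \<noteq> p v" if "u \<in> {1..n}" "v \<in> {1..n}" "u \<noteq> v" for u v
    using inj that by (auto dest: inj_onD)
  define q where "q x \<longleftrightarrow> (if even x = even h then p x < p (x + 1) else p (x + 1) < p x)" for x
  have q_Suc: "q (Suc x) \<longleftrightarrow> q x" if "1 \<le> x" "x + 2 \<le> n" for x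
  proof -
    have s: "p x < p (x + 1) \<longleftrightarrow> p (x + 2) < p (x + 1)"
      using sym[of 1 "x + 1"] that by simp
    have "p x \<noteq> p (x + 1)" "p (x + 1) \<noteq> p (x + 2)"
      using ne[of x "x + 1"] ne[of "x + 1" "x + 2"] that by auto
    with s show ?thesis by (auto simp: q_def)
  qed
  have q_iff: "q x \<longleftrightarrow> q 1" if "1 \<le> x" "x + 1 \<le> n" for x
    using that
  proof (induction x rule: dec_induct)
    case (step x)
    then show ?case using q_Suc[of x] by simp
  qed simp
  have "q 1"
  proof (cases "h = n")
    case True
    then have "q (n - 1)" using first n by (auto simp: q_def)
    then show ?thesis using q_iff[of "n - 1"] n by auto
  next
    case False
    then have "q h" using first n by (auto simp: q_def)
    then show ?thesis using q_iff[of h] False first(1) by auto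
  qed
  then have q: "q x" if "1 \<le> x" "x + 1 \<le> n" for x using q_iff that by blast
  \<comment> \<open>The inequalities put \<open>2 * y - z\<close> into \<open>[n]\<close>, so
    \<open>y\<close> is the middle of a progression with end \<open>z\<close>; if \<open>z\<close>
    lies below \<open>y\<close>, \<open>sym\<close> moves to the end above.\<close>
  have centre: "p (y + 1) < p y \<longleftrightarrow> p z < p y"
    if yz: "y \<in> {1..n}" "z \<in> {1..n}" "even y \<noteq> even z" "z < 2 * y" "2 * y \<le> n + z" for y z
  proof (cases "y < z")
    case True
    define d where "d = z - y"
    have z: "z = y + d" using True by (simp add: d_def)
    then have "odd d" "d < y" "y + d \<le> n" using yz by auto
    then show ?thesis using odd_step_order[OF inj sym, of d y] z by blast
  next
    case False
    define d where "d = y - z"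
    have z: "y = z + d" using False by (simp add: d_def)
    then have d: "odd d" "d < y" "y + d \<le> n" using yz by auto
    then have "p (y + d) < p y \<longleftrightarrow> p (y + 1) < p y"
      using odd_step_order[OF inj sym, of d y] by blast
    moreover have "p (y - d) < p y \<longleftrightarrow> p (y + d) < p y"
      using sym[of d y] d by (auto elim: oddE)
    moreover have "y - d = z" using z by simp
    ultimately show ?thesis by metis
  qed
  have uv: "p u \<noteq> p v" using u(1) v(1) uv_ne by (rule ne)
  show ?thesis
  proof (cases "u < 2 * v \<and> 2 * v \<le> n + u")
    case True
    then have "v + 1 \<le> n" using u(1) uv_ne by simp
    then have "p (v + 1) < p v" using q[of v] u v by (auto simp: q_def)
    then show ?thesis using centre[of v u] True u v by auto
  next
    case False
    then have c: "v < 2 * u" "2 * u \<le> n + v" using rel by (auto simp: related_def)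
    then have "u + 1 \<le> n" using v(1) uv_ne by simp
    then have "\<not> p (u + 1) < p u" using q[of u] u v by (auto simp: q_def)
    then show ?thesis using centre[of u v] c u v uv by auto
  qed
qed

section \<open>Halves of a list, and 3-freeness in terms of them\<close>

definition evens :: "nat list \<Rightarrow> nat list" where
  "evens xs = map (\<lambda>x. x div 2) (filter even xs)"

definition odds :: "nat list \<Rightarrow> nat list" where
  "odds xs = map (\<lambda>x. Suc x div 2) (filter odd xs)"

lemma evens_Nil [simp]: "evens [] = []" and odds_Nil [simp]: "odds [] = []"
  by (simp_all add: evens_def odds_def)

lemma evens_append: "evens (xs @ ys) = evens xs @ evens ys"
  and odds_append: "odds (xs @ ys) = odds xs @ odds ys"
  by (simp_all add: evens_def odds_def)

lemma evens_single: "evens [v] = (if even v then [v div 2] else [])"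
  and odds_single: "odds [v] = (if odd v then [Suc v div 2] else [])"
  by (simp_all add: evens_def odds_def)

lemma length_evens_odds: "length (evens xs) + length (odds xs) = length xs"
  using sum_length_filter_compl[of even xs] by (simp add: evens_def odds_def)

lemma set_evens: "i \<in> set (evens xs) \<longleftrightarrow> 2 * i \<in> set xs"
  by (force simp: evens_def)

lemma set_odds: "i \<in> set (odds xs) \<longleftrightarrow> 0 < i \<and> 2 * i - 1 \<in> set xs"
proof -
  have *: "odd x \<and> i = Suc x div 2 \<longleftrightarrow> 0 < i \<and> x = 2 * i - 1" for x
    by (auto elim!: oddE)
  have "i \<in> set (odds xs) \<longleftrightarrow> (\<exists>x\<in>set xs. odd x \<and> i = Suc x div 2)"
    unfolding odds_def by fastforce
  then show ?thesis unfolding * by blast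
qed

lemma map_evens: "map (\<lambda>i. 2 * i) (evens xs) = filter even xs"
  by (induction xs) (auto simp: evens_def)

lemma map_odds: "map (\<lambda>i. 2 * i - 1) (odds xs) = filter odd xs"
  by (induction xs) (auto simp: odds_def elim!: oddE)

lemma distinct_filter_split:
  "distinct xs \<longleftrightarrow> distinct (filter P xs) \<and> distinct (filter (\<lambda>x. \<not> P x) xs)"
proof
  show "distinct (filter P xs) \<and> distinct (filter (\<lambda>x. \<not> P x) xs) \<Longrightarrow> distinct xs"
    by (induction xs) (auto simp del: distinct_filter split: if_splits)
qed simp

lemma distinct_evens_odds: "distinct xs \<longleftrightarrow> distinct (evens xs) \<and> distinct (odds xs)"
proof -
  have "x div 2 = y div 2 \<longleftrightarrow> x = y" if "even x" "even y" for x y :: nat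
    using that by presburger
  then have "distinct (evens xs) \<longleftrightarrow> distinct (filter even xs)"
    by (auto simp: evens_def distinct_map inj_on_def)
  moreover have "Suc x div 2 = Suc y div 2 \<longleftrightarrow> x = y" if "odd x" "odd y" for x y :: nat
    using that by presburger
  then have "distinct (odds xs) \<longleftrightarrow> distinct (filter odd xs)"
    by (auto simp: odds_def distinct_map inj_on_def)
  moreover have "distinct xs \<longleftrightarrow> distinct (filter even xs) \<and> distinct (filter odd xs)"
    by (rule distinct_filter_split)
  ultimately show ?thesis by blast
qed

lemma subseq_Cons_iff:
  "subseq (y # ys) xs \<longleftrightarrow> (\<exists>j<length xs. xs ! j = y \<and> subseq ys (drop (Suc j) xs))"
proof
  assume "subseq (y # ys) xs"
  then obtain us vs where "xs = us @ y # vs" "subseq ys vs"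
    by (auto dest: list_emb_ConsD)
  then show "\<exists>j<length xs. xs ! j = y \<and> subseq ys (drop (Suc j) xs)"
    by (intro exI[of _ "length us"]) auto
next
  assume "\<exists>j<length xs. xs ! j = y \<and> subseq ys (drop (Suc j) xs)"
  then obtain j where j: "j < length xs" "xs ! j = y" "subseq ys (drop (Suc j) xs)" by blast
  have "subseq (y # ys) (take j xs @ y # drop (Suc j) xs)" 
    using j(3) by (intro list_emb_append2 subseq_Cons2)
  then show "subseq (y # ys) xs" using j id_take_nth_drop by metis
qed

lemma subseq_triple_iff:
  "subseq [x, y, z] xs \<longleftrightarrow>
     (\<exists>i j k. i < j \<and> j < k \<and> k < length xs \<and> xs ! i = x \<and> xs ! j = y \<and> xs ! k = z)"
proof
  assume "subseq [x, y, z] xs"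
  then obtain us vs ws rs where "xs = us @ x # vs @ y # ws @ z # rs"
    by (blast dest: list_emb_ConsD)
  then show "\<exists>i j k. i < j \<and> j < k \<and> k < length xs \<and> xs ! i = x \<and> xs ! j = y \<and> xs ! k = z"
    by (intro exI[of _ "length us"] exI[of _ "length us + Suc (length vs)"]
        exI[of _ "length us + Suc (length vs + Suc (length ws))"]) (auto simp: nth_append)
next
  assume "\<exists>i j k. i < j \<and> j < k \<and> k < length xs \<and> xs ! i = x \<and> xs ! j = y \<and> xs ! k = z"
  then obtain i j k where "i < j" "j < k" "k < length xs" "xs ! i = x" "xs ! j = y" "xs ! k = z"
    by blast
  then show "subseq [x, y, z] xs"
    unfolding subseq_Cons_iff
    by (intro exI[of _ i] exI[of _ "j - Suc i"] exI[of _ "k - Suc j"] conjI) auto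
qed

text \<open>In terms of subsequences, 3-freeness is easily carried through the \<open>filter\<close>
  and \<open>map\<close> that form the halves.\<close>

lemma three_free_subseq: "three_free xs \<longleftrightarrow> (\<forall>x y z. subseq [x, y, z] xs \<longrightarrow> x + z \<noteq> 2 * y)"
  unfolding three_free_def subseq_triple_iff by blast

lemma three_free_evens:
  assumes "three_free xs" shows "three_free (evens xs)"
  unfolding three_free_subseq
proof (intro allI impI)
  fix x y z assume "subseq [x, y, z] (evens xs)"
  then have "subseq (map (\<lambda>i. 2 * i) [x, y, z]) (map (\<lambda>i. 2 * i) (evens xs))"
    by (rule subseq_map)
  then have "subseq [2 * x, 2 * y, 2 * z] xs"
    using subseq_order.trans[OF _ subseq_filter_left] unfolding map_evens by simp
  with assms show "x + z \<noteq> 2 * y" unfolding three_free_subseq by fastforce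
qed

lemma three_free_odds:
  assumes "three_free xs" shows "three_free (odds xs)"
  unfolding three_free_subseq
proof (intro allI impI)
  fix x y z assume s: "subseq [x, y, z] (odds xs)"
  have "set [x, y, z] \<subseteq> set (odds xs)" 
    by (meson s subseq_order.trans subseq_singleton_left subsetI)
  moreover have "0 \<notin> set (odds xs)" by (auto simp: odds_def elim!: oddE)
  ultimately have pos: "0 < x" "0 < y" "0 < z" by (auto intro: Nat.gr0I)
  from s have "subseq (map (\<lambda>i. 2 * i - 1) [x, y, z]) (map (\<lambda>i. 2 * i - 1) (odds xs))"
    by (rule subseq_map)
  then have "subseq [2 * x - 1, 2 * y - 1, 2 * z - 1] xs"
    using subseq_order.trans[OF _ subseq_filter_left] unfolding map_odds by simp
  with assms have "2 * x - 1 + (2 * z - 1) \<noteq> 2 * (2 * y - 1)" unfolding three_free_subseq by blast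
  with pos show "x + z \<noteq> 2 * y" by simp
qed

text \<open>The flag \<open>b\<close> tells whether the evens lead. The number \<open>w\<close>
  ranges over all of \<open>[n]\<close>, not just over \<open>xs\<close>, so that the condition also
  fits an unfinished permutation: an entry is refused while a related one of the leading parity is
  still outstanding.\<close>

definition half_ordered :: "bool \<Rightarrow> nat \<Rightarrow> nat list \<Rightarrow> bool" where
  "half_ordered b n xs \<longleftrightarrow> (\<forall>i<length xs. even (xs ! i) \<noteq> b \<longrightarrow>
     (\<forall>w\<in>{1..n}. even w = b \<longrightarrow> related n w (xs ! i) \<longrightarrow> w \<in> set (take i xs)))"

lemma half_ordered_Nil [simp]: "half_ordered b n []"
  by (simp add: half_ordered_def)

lemma half_ordered_snoc:
  "half_ordered b n (xs @ [v]) \<longleftrightarrow> half_ordered b n xs \<and>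
     (even v \<noteq> b \<longrightarrow> (\<forall>w\<in>{1..n}. even w = b \<longrightarrow> related n w v \<longrightarrow> w \<in> set xs))"
  unfolding half_ordered_def length_append_singleton All_less_Suc
  by (auto simp: nth_append)

text \<open>Forward, the order condition is \<open>related_order\<close> applied to positions.
  Backward, the ends of a progression have equal parity. If the middle shares it, the progression
  lies in one half. Otherwise the middle is related to both ends, and the order condition puts it
  before both or after both, according to which parity leads.\<close>

lemma three_free_iff_halves:
  assumes perm: "distinct xs" "set xs = {1..n}" and n: "0 < n"
  shows "three_free xs \<longleftrightarrow> three_free (evens xs) \<and> three_free (odds xs) \<and> half_ordered (even (hd xs)) n xs"
    (is "?L \<longleftrightarrow> ?E \<and> ?O \<and> ?R")
proof (intro iffI conjI)
  assume tf: ?L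
  show ?E ?O by (fact three_free_evens[OF tf], fact three_free_odds[OF tf])
  define idx where "idx x = (THE i. i < length xs \<and> xs ! i = x)" for x
  have idx_nth: "idx (xs ! i) = i" if "i < length xs" for i
    unfolding idx_def using that perm(1) by (auto simp: nth_eq_iff_index_eq)
  have idx: "idx x < length xs" "xs ! idx x = x" if "x \<in> {1..n}" for x
    using that perm(2) idx_nth by (metis in_set_conv_nth)+
  define p where "p x = int (idx x)" for x
  have inj: "inj_on p {1..n}"
    by (rule inj_onI) (metis p_def idx(2) of_nat_eq_iff)
  \<comment> \<open>This is 3-freeness: the middle term stands before both ends or after
    both.\<close>
  have sym: "p (y - d) < p y \<longleftrightarrow> p (y + d) < p y" if d: "0 < d" "d < y" "y + d \<le> n" for y d
  proof -
    let ?x = "y - d" and ?z = "y + d"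
    have mem: "?x \<in> {1..n}" "y \<in> {1..n}" "?z \<in> {1..n}" using d by auto
    have "xs ! idx ?x + xs ! idx ?z = 2 * xs ! idx y" "xs ! idx ?z + xs ! idx ?x = 2 * xs ! idx y"
      using idx(2)[OF mem(1)] idx(2)[OF mem(2)] idx(2)[OF mem(3)] d by simp_all
    then have "\<not> (idx ?x < idx y \<and> idx y < idx ?z)" "\<not> (idx ?z < idx y \<and> idx y < idx ?x)"
      using tf idx(1)[OF mem(1)] idx(1)[OF mem(3)] unfolding three_free_def by blast+
    moreover have "idx ?x \<noteq> idx y" "idx ?z \<noteq> idx y"
      using idx(2)[OF mem(1)] idx(2)[OF mem(2)] idx(2)[OF mem(3)] d by auto
    ultimately show ?thesis by (auto simp: p_def)
  qed
  have ne: "xs \<noteq> []" using perm(2) n by auto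
  then have hd: "hd xs \<in> {1..n}" using perm(2) hd_in_set by blast
  have first: "p (hd xs) < p x" if "x \<in> {1..n}" "x \<noteq> hd xs" for x
    using that idx[OF that(1)] idx_nth[of 0] ne by (cases "idx x") (auto simp: p_def hd_conv_nth)
  show ?R
    unfolding half_ordered_def
  proof (intro allI impI ballI)
    fix i w assume i: "i < length xs" "even (xs ! i) \<noteq> even (hd xs)"
      and w: "w \<in> {1..n}" "even w = even (hd xs)" "related n w (xs ! i)"
    have "xs ! i \<in> {1..n}" using i perm(2) nth_mem by blast
    then have "p w < p (xs ! i)"
      using related_order[OF inj sym hd first w(1,2) _ i(2) w(3)] by blast
    then have "idx w < i" using idx_nth i by (simp add: p_def)
    then show "w \<in> set (take i xs)"
      using idx[OF w(1)] by (auto simp: in_set_conv_nth intro!: exI[of _ "idx w"])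
  qed
next
  assume R: "?E \<and> ?O \<and> ?R"
  show ?L
    unfolding three_free_def
  proof clarify
    fix i j k assume ijk: "i < j" "j < k" "k < length xs" and ap: "xs ! i + xs ! k = 2 * xs ! j"
    define x y z where xyz: "x = xs ! i" "y = xs ! j" "z = xs ! k"
    have mem: "x \<in> {1..n}" "y \<in> {1..n}" "z \<in> {1..n}"
      using ijk perm(2) nth_mem by (auto simp: xyz simp del: atLeastAtMost_iff)
    have ap': "x + z = 2 * y" using ap by (simp add: xyz)
    then have par: "even x \<longleftrightarrow> even z" by presburger
    have sub: "subseq [x, y, z] xs"
      using ijk unfolding subseq_triple_iff xyz by blast
    consider "even x" "even y" | "odd x" "odd y" | "even x \<noteq> even y" by blast
    then show False
    proof cases
      case 1
      have "subseq (evens [x, y, z]) (evens xs)"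
        unfolding evens_def by (intro subseq_map subseq_filter sub)
      then have "subseq [x div 2, y div 2, z div 2] (evens xs)" using 1 par by (simp add: evens_def)
      moreover have "x div 2 + z div 2 = 2 * (y div 2)" using 1 par ap' by (auto elim!: evenE)
      ultimately show False using R unfolding three_free_subseq by blast
    next
      case 2
      have "subseq (odds [x, y, z]) (odds xs)"
        unfolding odds_def by (intro subseq_map subseq_filter sub)
      then have "subseq [Suc x div 2, Suc y div 2, Suc z div 2] (odds xs)" using 2 par by (simp add: odds_def)
      moreover have "Suc x div 2 + Suc z div 2 = 2 * (Suc y div 2)" using 2 par ap' by (auto elim!: oddE)
      ultimately show False using R unfolding three_free_subseq by blast
    next
      case 3
      have rel: "related n z y" "related n y x"
        using mem ap' by (auto simp: related_def)
      have not_before: "xs ! l' \<notin> set (take l xs)" if "l < l'" "l' < length xs" for l l'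
        using perm(1) that by (auto simp: in_set_conv_nth nth_eq_iff_index_eq)
      show False
      proof (cases "even y = even (hd xs)")
        case True
        with 3 R rel(2) mem ijk have "y \<in> set (take i xs)"
          unfolding half_ordered_def xyz by (metis order.strict_trans)
        with not_before[of i j] ijk show False by (simp add: xyz)
      next
        case False
        with 3 par have "even z = even (hd xs)" by blast
        with False R rel(1) mem ijk have "z \<in> set (take j xs)"
          unfolding half_ordered_def xyz by (metis order.strict_trans)
        with not_before[of j k] ijk show False by (simp add: xyz)
      qed
    qed
  qed
qed

section \<open>The automaton\<close>

text \<open>
  A state encodes the set of entries read so far: \<open>Split b A B\<close> is a proper nonempty subset of
  \<open>{1..2m}\<close> whose elements \<open>2i\<close> and \<open>2j - 1\<close> are given by the states \<open>A\<close> and \<open>B\<close>; the flag tells whether the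
  first entry was even. Sizes, bounds and counts are of type \<^typ>\<open>num\<close>, and case distinctions are
  made by pattern matching on a Boolean argument, to keep the evaluation by the simplifier cheap.
\<close>

datatype state = Empty | Full | Split bool state state

text \<open>\<open>half_up\<close> is the ceiling of \<open>x / 2\<close>, \<open>half_Suc\<close>
  the floor plus one. They turn a lower bound on \<open>2 * i\<close> or \<open>2 * j - 1\<close>
  into one on \<open>i\<close> or \<open>j\<close>. Upper bounds are kept as lower bounds on
  \<open>n + 1 - v\<close>, which avoids subtraction; this reflection changes parity, so there the
  two functions trade places.\<close>

fun half_up :: "num \<Rightarrow> num" where
  "half_up num.One = num.One"
| "half_up (num.Bit0 x) = x"
| "half_up (num.Bit1 x) = Num.inc x"

fun half_Suc :: "num \<Rightarrow> num" where
  "half_Suc num.One = num.One"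
| "half_Suc (num.Bit0 x) = Num.inc x"
| "half_Suc (num.Bit1 x) = Num.inc x"

fun num_sel :: "bool \<Rightarrow> num \<Rightarrow> num \<Rightarrow> num" where
  "num_sel True x y = x"
| "num_sel False x y = y"

definition num_max :: "num \<Rightarrow> num \<Rightarrow> num" where
  "num_max x y = num_sel (y \<le> x) x y"

text \<open>
  For a set \<open>S \<noteq> [n]\<close>, \<open>top_gap n S\<close> is the largest missing element and \<open>n + 1 - bot_gap n S\<close> the smallest.
\<close>

fun top_gap :: "num \<Rightarrow> state \<Rightarrow> num" where
  "top_gap n Empty = n"
| "top_gap (num.Bit0 m) (Split b Full B) = Num.BitM (top_gap m B)"
| "top_gap (num.Bit0 m) (Split b A B) = num_max (num.Bit0 (top_gap m A)) (Num.BitM (top_gap m B))"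
| "top_gap _ _ = num.One"

fun bot_gap :: "num \<Rightarrow> state \<Rightarrow> num" where
  "bot_gap n Empty = n"
| "bot_gap (num.Bit0 m) (Split b A Full) = Num.BitM (bot_gap m A)"
| "bot_gap (num.Bit0 m) (Split b A B) = num_max (Num.BitM (bot_gap m A)) (num.Bit0 (bot_gap m B))"
| "bot_gap _ _ = num.One"

definition far_limit :: "num \<Rightarrow> num \<Rightarrow> num" where
  "far_limit m t = num_max (Num.BitM t) (half_up (m + t))"

definition near_limit :: "num \<Rightarrow> num \<Rightarrow> num" where
  "near_limit m t = num_max (num.Bit1 t) (half_up (m + num.Bit0 num.One + t))"

text \<open>\<open>num.One\<close> is the trivial bound. The same test on \<open>t\<close> serves
  both functions, so at most one of the two limits is active. When missing indices lie in both
  halves of \<open>[m]\<close>, \<open>near_limit\<close> exceeds \<open>m\<close> and leaves no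
  move.\<close>

fun far_bound :: "num \<Rightarrow> state \<Rightarrow> num \<Rightarrow> num" where
  "far_bound m Full t = num.One"
| "far_bound m S t = num_sel (num.Bit0 t \<le> m) (far_limit m t) num.One"

fun near_bound :: "num \<Rightarrow> state \<Rightarrow> num \<Rightarrow> num \<Rightarrow> num" where
  "near_bound m Full t s = num.One"
| "near_bound m S t s = num_sel (num.Bit0 t \<le> m) num.One (near_limit m s)"

text \<open>A normal form: a full set is always \<open>Full\<close> and its flag is forgotten, so
  that such words share one state. Emptiness needs no such care, as a state is joined only after a
  move.\<close>

fun join :: "bool \<Rightarrow> state \<Rightarrow> state \<Rightarrow> state" where
  "join b Full Full = Full"
| "join b A B = Split b A B"

fun join_left :: "bool \<Rightarrow> state \<Rightarrow> state list \<Rightarrow> state list \<Rightarrow> state list" where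
  "join_left b B [] Ss = Ss"
| "join_left b B (A # As) Ss = join b A B # join_left b B As Ss"

fun join_right :: "bool \<Rightarrow> state \<Rightarrow> state list \<Rightarrow> state list" where
  "join_right b A [] = []"
| "join_right b A (B # Bs) = join b A B # join_right b A Bs"

text \<open>
  \<open>moves n lo hi S\<close> lists the successors of \<open>S\<close> under the elements \<open>v\<close> with \<open>lo \<le> v\<close> and \<open>hi \<le> n + 1 - v\<close>.
  If the evens go first, an odd \<open>2j - 1\<close> may be read iff it is unrelated to all missing evens \<open>2i\<close>.
  This happens only if those \<open>i\<close> all lie in the upper half of \<open>[m]\<close>, which bounds \<open>j\<close> from above
  (\<open>far_limit\<close>), or all in the lower half, which bounds \<open>j\<close> from below (\<open>near_limit\<close>).
  Evens need no check, as reading an odd required all its related evens.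
\<close>

function (sequential) moves :: "num \<Rightarrow> num \<Rightarrow> num \<Rightarrow> state \<Rightarrow> state list"
  and moves_if :: "bool \<Rightarrow> num \<Rightarrow> num \<Rightarrow> num \<Rightarrow> state \<Rightarrow> state list"
where
  "moves n lo hi S = moves_if (lo + hi \<le> Num.inc n) n lo hi S"
| "moves_if False n lo hi S = []"
| "moves_if True n lo hi Full = []"
| "moves_if True num.One lo hi Empty = [Full]"
| "moves_if True (num.Bit0 m) lo hi Empty =
     join_left True Empty (moves m (half_up lo) (half_Suc hi) Empty)
       (join_right False Empty (moves m (half_Suc lo) (half_up hi) Empty))"
| "moves_if True (num.Bit0 m) lo hi (Split True A B) =
     join_left True B (moves m (half_up lo) (half_Suc hi) A)
       (join_right True A
         (moves m (num_max (half_Suc lo) (near_bound m A (bot_gap m A) (top_gap m A)))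
            (num_max (half_up hi) (far_bound m A (bot_gap m A))) B))"
| "moves_if True (num.Bit0 m) lo hi (Split False A B) =
     join_left False B
       (moves m (num_max (half_up lo) (far_bound m B (top_gap m B)))
          (num_max (half_Suc hi) (near_bound m B (top_gap m B) (bot_gap m B))) A)
       (join_right False A (moves m (half_Suc lo) (half_up hi) B))"
| "moves_if True _ lo hi _ = []"
  by pat_completeness auto
termination
  by (relation "measure (\<lambda>v. case v of Inl (n, _) \<Rightarrow> 2 * size n + 1 | Inr (_, n, _) \<Rightarrow> 2 * size n)") auto

section \<open>Layers of states with multiplicities, and merging them\<close>

datatype comparison = Lt | Eq | Gt

fun cmp :: "state \<Rightarrow> state \<Rightarrow> comparison"
  and cmp_then :: "comparison \<Rightarrow> state \<Rightarrow> state \<Rightarrow> comparison"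
where
  "cmp Empty Empty = Eq"
| "cmp Empty Full = Lt"
| "cmp Empty (Split b A B) = Lt"
| "cmp Full Empty = Gt"
| "cmp Full Full = Eq"
| "cmp Full (Split b A B) = Gt"
| "cmp (Split b A B) Empty = Gt"
| "cmp (Split b A B) Full = Lt"
| "cmp (Split True A B) (Split True A' B') = cmp_then (cmp A A') B B'"
| "cmp (Split False A B) (Split False A' B') = cmp_then (cmp A A') B B'"
| "cmp (Split True A B) (Split False A' B') = Lt"
| "cmp (Split False A B) (Split True A' B') = Gt"
| "cmp_then Lt B B' = Lt"
| "cmp_then Eq B B' = cmp B B'"
| "cmp_then Gt B B' = Gt"

type_synonym layer = "(state \<times> num) list"

function (sequential) merge :: "layer \<Rightarrow> layer \<Rightarrow> layer"
  and merge_by :: "comparison \<Rightarrow> state \<times> num \<Rightarrow> layer \<Rightarrow> state \<times> num \<Rightarrow> layer \<Rightarrow> layer"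
where
  "merge [] ys = ys"
| "merge (x # xs) [] = x # xs"
| "merge (x # xs) (y # ys) = merge_by (cmp (fst x) (fst y)) x xs y ys"
| "merge_by Lt x xs y ys = x # merge xs (y # ys)"
| "merge_by Gt x xs y ys = y # merge (x # xs) ys"
| "merge_by Eq x xs y ys = (fst x, snd x + snd y) # merge xs ys"
  by pat_completeness auto
termination
  by (relation "measure (\<lambda>v. case v of Inl (xs, ys) \<Rightarrow> 2 * (length xs + length ys)
     | Inr (_, _, xs, _, ys) \<Rightarrow> 2 * (length xs + length ys) + 3)") auto

fun merge_pairs :: "layer list \<Rightarrow> layer list" where
  "merge_pairs (x # y # Ls) = merge x y # merge_pairs Ls"
| "merge_pairs Ls = Ls"

lemma length_merge_pairs: "length (merge_pairs Ls) \<le> length Ls"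
  by (induction Ls rule: merge_pairs.induct) auto

text \<open>Rounds of pairwise merging, as in merge sort: every round halves the number of layers,
  which keeps the number of comparisons low.\<close>

function merge_all :: "layer list \<Rightarrow> layer" where
  "merge_all [] = []"
| "merge_all [x] = x"
| "merge_all (x # y # Ls) = merge_all (merge x y # merge_pairs Ls)"
  by pat_completeness auto
termination
  by (relation "measure length") (auto simp: length_merge_pairs less_Suc_eq_le)

fun tag :: "num \<Rightarrow> state list \<Rightarrow> layer list \<Rightarrow> layer list" where
  "tag c [] Ls = Ls"
| "tag c (S # Ss) Ls = [(S, c)] # tag c Ss Ls"

fun expand :: "num \<Rightarrow> layer \<Rightarrow> layer list" where
  "expand n [] = []"
| "expand n ((S, c) # L) = tag c (moves n num.One num.One S) (expand n L)"

definition next_layer :: "num \<Rightarrow> layer \<Rightarrow> layer" where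
  "next_layer n L = merge_all (expand n L)"

text \<open>Recursion along the binary digits of the number of steps, so that no counter has to be
  decremented.\<close>

fun iter_layer :: "num \<Rightarrow> num \<Rightarrow> layer \<Rightarrow> layer" where
  "iter_layer n num.One L = next_layer n L"
| "iter_layer n (num.Bit0 k) L = iter_layer n k (iter_layer n k L)"
| "iter_layer n (num.Bit1 k) L = next_layer n (iter_layer n k (iter_layer n k L))"

lemmas layer_eval = half_up.simps half_Suc.simps num_sel.simps num_max_def top_gap.simps bot_gap.simps
  far_limit_def near_limit_def far_bound.simps near_bound.simps join.simps join_left.simps join_right.simps
  moves.simps moves_if.simps cmp.simps cmp_then.simps merge.simps merge_by.simps merge_pairs.simps
  merge_all.simps tag.simps expand.simps next_layer_def iter_layer.simps
  Num.inc.simps Num.BitM.simps add_num_simps le_num_simps less_num_simps fst_conv snd_conv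

section \<open>Correctness of the automaton\<close>

lemma nat_of_num_BitM: "nat_of_num (Num.BitM x) = 2 * nat_of_num x - 1"
  using arg_cong[OF BitM_plus_one[of x], of nat_of_num] by (simp add: nat_of_num_add)

lemma nat_of_num_half_up: "nat_of_num (half_up x) = (nat_of_num x + 1) div 2"
  by (cases x) (auto simp: nat_of_num_inc)

lemma nat_of_num_half_Suc: "nat_of_num (half_Suc x) = nat_of_num x div 2 + 1"
  by (cases x) (auto simp: nat_of_num_inc)

lemma num_sel_if: "num_sel b x y = (if b then x else y)"
  by (cases b) auto

lemma nat_of_num_max: "nat_of_num (num_max x y) = max (nat_of_num x) (nat_of_num y)"
  by (auto simp: num_max_def num_sel_if less_eq_num_def)

lemma nat_of_num_far_limit:
  "nat_of_num (far_limit m t) = max (2 * nat_of_num t - 1) ((nat_of_num m + nat_of_num t + 1) div 2)"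
  by (simp add: far_limit_def nat_of_num_max nat_of_num_BitM nat_of_num_half_up nat_of_num_add)

lemma nat_of_num_near_limit:
  "nat_of_num (near_limit m t) = max (2 * nat_of_num t + 1) ((nat_of_num m + nat_of_num t + 3) div 2)"
  by (simp add: near_limit_def nat_of_num_max nat_of_num_half_up nat_of_num_add)

lemma far_bound_if: "far_bound m S t =
    (if S = Full then num.One else if 2 * nat_of_num t \<le> nat_of_num m then far_limit m t else num.One)"
  by (cases S) (auto simp: num_sel_if less_eq_num_def)

lemma near_bound_if: "near_bound m S t s =
    (if S = Full then num.One else if 2 * nat_of_num t \<le> nat_of_num m then num.One else near_limit m s)"
  by (cases S) (auto simp: num_sel_if less_eq_num_def)

text \<open>A full half has the default gap 1. In the even half it would stand for the element 2 and
  could exceed a true maximum of 1, so this case is separate; in the odd half it stands for 1, which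
  is below every \<open>2 * a\<close>. For \<open>bot_gap\<close> the halves exchange roles.\<close>

lemma top_gap_Split: "top_gap (num.Bit0 m) (Split b A B) =
    (if A = Full then Num.BitM (top_gap m B)
     else num_max (num.Bit0 (top_gap m A)) (Num.BitM (top_gap m B)))"
  by (cases A) auto

lemma bot_gap_Split: "bot_gap (num.Bit0 m) (Split b A B) =
    (if B = Full then Num.BitM (bot_gap m A)
     else num_max (Num.BitM (bot_gap m A)) (num.Bit0 (bot_gap m B)))"
  by (cases A; cases B) auto

lemma top_gap_Full: "top_gap n Full = num.One" and bot_gap_Full: "bot_gap n Full = num.One"
  by (cases n; simp)+

lemma join_if: "join b A B = (if A = Full \<and> B = Full then Full else Split b A B)"
  by (cases A; cases B) auto

text \<open>\<open>three_free_iff_halves\<close> unfolded down to single elements, but also for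
  unfinished words. Distinctness and the range \<open>[2^k]\<close> are already implied by the base
  case (\<open>live_distinct\<close>, \<open>live_subset\<close>).\<close>

primrec live :: "nat \<Rightarrow> nat list \<Rightarrow> bool" where
  "live 0 xs \<longleftrightarrow> xs = [] \<or> xs = [1]"
| "live (Suc k) xs \<longleftrightarrow> live k (evens xs) \<and> live k (odds xs) \<and> half_ordered (even (hd xs)) (2 ^ Suc k) xs"

primrec state_of :: "nat \<Rightarrow> nat list \<Rightarrow> state" where
  "state_of 0 xs = (if xs = [] then Empty else Full)"
| "state_of (Suc k) xs = (if xs = [] then Empty else if length xs = 2 ^ Suc k then Full
     else Split (even (hd xs)) (state_of k (evens xs)) (state_of k (odds xs)))"

definition missing :: "nat \<Rightarrow> nat list \<Rightarrow> nat set" where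
  "missing k xs = {1..2 ^ k} - set xs"

lemma live_Nil [simp]: "live k []"
  by (induction k) auto

lemma nat_halves_cases:
  obtains i where "x = 2 * i" | j where "0 < j" "x = 2 * j - (1::nat)"
proof (cases "even x")
  case True
  then show ?thesis using that(1) by (auto elim!: evenE)
next
  case False
  then show ?thesis using that(2)[of "Suc x div 2"] by (auto elim!: oddE)
qed

lemma live_distinct: "live k xs \<Longrightarrow> distinct xs"
proof (induction k arbitrary: xs)
  case (Suc k)
  then show ?case using distinct_evens_odds[of xs] by simp
qed auto

lemma live_subset: "live k xs \<Longrightarrow> set xs \<subseteq> {1..2 ^ k}"
proof (induction k arbitrary: xs)
  case (Suc k)
  then have IH: "set (evens xs) \<subseteq> {1..2 ^ k}" "set (odds xs) \<subseteq> {1..2 ^ k}" by auto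
  show ?case
  proof
    fix x assume x: "x \<in> set xs"
    show "x \<in> {1..2 ^ Suc k}"
    proof (cases x rule: nat_halves_cases)
      case (1 i)
      then have "i \<in> set (evens xs)" using x by (simp add: set_evens)
      then show ?thesis using IH(1) 1 by fastforce
    next
      case (2 j)
      then have "j \<in> set (odds xs)" using x by (simp add: set_odds)
      then have "1 \<le> j" "j \<le> 2 ^ k" using IH(2) by auto
      then show ?thesis using 2 by auto
    qed
  qed
qed auto

lemma live_length_le: "live k xs \<Longrightarrow> length xs \<le> 2 ^ k"
  using card_mono[OF _ live_subset] live_distinct by (fastforce simp: distinct_card)

lemma live_full: "live k xs \<Longrightarrow> length xs = 2 ^ k \<longleftrightarrow> missing k xs = {}"
proof -
  assume l: "live k xs"
  have "card (set xs) = length xs" using live_distinct[OF l] by (rule distinct_card)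
  then have "length xs = 2 ^ k \<longleftrightarrow> set xs = {1..2 ^ k}"
    using card_subset_eq[OF _ live_subset[OF l]] by auto
  then show ?thesis using live_subset[OF l] by (auto simp: missing_def)
qed

lemma state_of_Empty [simp]: "state_of k xs = Empty \<longleftrightarrow> xs = []"
  by (cases k) auto

lemma state_of_Nil [simp]: "state_of k [] = Empty"
  by (cases k) auto

lemma state_of_Full: "live k xs \<Longrightarrow> state_of k xs = Full \<longleftrightarrow> length xs = 2 ^ k"
  by (cases k) auto

lemma state_of_Full_missing: "live k xs \<Longrightarrow> state_of k xs = Full \<longleftrightarrow> missing k xs = {}"
  by (simp add: state_of_Full live_full)

text \<open>Each half has at most \<open>2 ^ k\<close> entries, so the whole word is full only if
  both halves are.\<close>

lemma state_of_join:
  assumes "live (Suc k) xs" "xs \<noteq> []"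
  shows "state_of (Suc k) xs = join (even (hd xs)) (state_of k (evens xs)) (state_of k (odds xs))"
proof -
  have l: "live k (evens xs)" "live k (odds xs)" using assms by auto
  have "length xs = 2 ^ Suc k \<longleftrightarrow> length (evens xs) = 2 ^ k \<and> length (odds xs) = 2 ^ k"
    using live_length_le[OF l(1)] live_length_le[OF l(2)] length_evens_odds[of xs] by auto
  then show ?thesis using assms(2) by (simp add: join_if state_of_Full[OF l(1)] state_of_Full[OF l(2)])
qed

lemma missing_even: "2 * i \<in> missing (Suc k) xs \<longleftrightarrow> i \<in> missing k (evens xs)"
  by (auto simp: missing_def set_evens)

lemma missing_odd: "0 < j \<Longrightarrow> 2 * j - 1 \<in> missing (Suc k) xs \<longleftrightarrow> j \<in> missing k (odds xs)"
  by (auto simp: missing_def set_odds)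

lemma missing_pos: "j \<in> missing k xs \<Longrightarrow> 0 < j \<and> j \<le> 2 ^ k"
  by (auto simp: missing_def)

lemma ball_missing: "(\<forall>x\<in>missing (Suc k) xs. P x) \<longleftrightarrow>
    (\<forall>i\<in>missing k (evens xs). P (2 * i)) \<and> (\<forall>j\<in>missing k (odds xs). P (2 * j - 1))"
  by (metis missing_even missing_odd missing_pos nat_halves_cases)

lemma nat_of_num_power_Suc:
  assumes "nat_of_num n = 2 ^ Suc k"
  obtains m where "n = num.Bit0 m" "nat_of_num m = 2 ^ k"
  using assms
proof (cases n)
  case (Bit1 x)
  then show ?thesis using arg_cong[OF assms, of even] by simp
qed auto

lemma nat_of_num_eq_1: "nat_of_num n = 1 \<longleftrightarrow> n = num.One"
  using num_eq_iff[of n num.One] by simp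

lemma state_of_Suc_cases:
  assumes "live (Suc k) xs" "state_of (Suc k) xs \<noteq> Full"
  obtains "xs = []" | "xs \<noteq> []" "state_of (Suc k) xs = Split (even (hd xs)) (state_of k (evens xs)) (state_of k (odds xs))"
    "\<not> (state_of k (evens xs) = Full \<and> state_of k (odds xs) = Full)"
  using assms state_of_join[OF assms(1)] by (cases "xs = []") (auto simp: join_if split: if_splits)

section \<open>Largest and smallest missing elements\<close>

lemma top_gap:
  assumes "nat_of_num n = 2 ^ k" "live k xs" "state_of k xs \<noteq> Full"
  shows "nat_of_num (top_gap n (state_of k xs)) \<in> missing k xs \<and>
    (\<forall>x\<in>missing k xs. x \<le> nat_of_num (top_gap n (state_of k xs)))"
  using assms
proof (induction k arbitrary: n xs)
  case 0
  then show ?case by (auto simp: nat_of_num_eq_1 missing_def split: if_splits)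
next
  case (Suc k)
  obtain m where m: "n = num.Bit0 m" "nat_of_num m = 2 ^ k"
    using nat_of_num_power_Suc[OF Suc.prems(1)] .
  have l: "live k (evens xs)" "live k (odds xs)" using Suc.prems by auto
  from Suc.prems(2,3) show ?case
  proof (cases rule: state_of_Suc_cases)
    case 1
    then show ?thesis using m by (auto simp: missing_def Suc_le_eq)
  next
    case 2
    let ?A = "state_of k (evens xs)" and ?B = "state_of k (odds xs)"
    have A: "nat_of_num (top_gap m ?A) \<in> missing k (evens xs)"
      "\<And>x. x \<in> missing k (evens xs) \<Longrightarrow> x \<le> nat_of_num (top_gap m ?A)" if "?A \<noteq> Full"
      using Suc.IH[OF m(2) l(1) that] by auto
    have B: "nat_of_num (top_gap m ?B) \<in> missing k (odds xs)"
      "\<And>x. x \<in> missing k (odds xs) \<Longrightarrow> x \<le> nat_of_num (top_gap m ?B)" if "?B \<noteq> Full"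
      using Suc.IH[OF m(2) l(2) that] by auto
    have E: "missing k (evens xs) = {}" if "?A = Full" using state_of_Full_missing[OF l(1)] that by simp
    have O: "missing k (odds xs) = {}" if "?B = Full" using state_of_Full_missing[OF l(2)] that by simp
    define a where "a = nat_of_num (top_gap m ?A)"
    define b where "b = nat_of_num (top_gap m ?B)"
    have pos: "0 < a" "0 < b" by (simp_all add: a_def b_def nat_of_num_pos)
    have top: "nat_of_num (top_gap n (state_of (Suc k) xs)) = (if ?A = Full then 2 * b - 1 else max (2 * a) (2 * b - 1))"
      unfolding 2(2) m(1) top_gap_Split by (simp add: nat_of_num_max nat_of_num_BitM a_def b_def mult_2)
    consider "?A = Full" "?B \<noteq> Full" | "?A \<noteq> Full" "?B = Full" | "?A \<noteq> Full" "?B \<noteq> Full"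
      using 2(3) by blast
    then show ?thesis
    proof cases
      case 1
      then show ?thesis unfolding ball_missing top using E B pos
        by (auto simp: missing_odd[simplified] simp flip: b_def intro!: diff_le_mono)
    next
      case c: 2
      then have "b = 1" by (simp add: b_def top_gap_Full)
      then show ?thesis unfolding ball_missing top using c O A pos
        by (auto simp: missing_even simp flip: a_def)
    next
      case 3
      note A = A[OF 3(1), folded a_def] and B = B[OF 3(2), folded b_def]
      show ?thesis
      proof (cases "b \<le> a")
        case True
        then have *: "nat_of_num (top_gap n (state_of (Suc k) xs)) = 2 * a" using top 3 by simp
        have "2 * x - 1 \<le> 2 * a" if "x \<in> missing k (odds xs)" for x
          using B(2)[OF that] True by simp
        then show ?thesis unfolding ball_missing * using A by (auto simp: missing_even)
      next
        case False
        then have *: "nat_of_num (top_gap n (state_of (Suc k) xs)) = 2 * b - 1" using top 3 by simp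
        have "2 * x \<le> 2 * b - 1" if "x \<in> missing k (evens xs)" for x
          using A(2)[OF that] False by simp
        moreover have "2 * x - 1 \<le> 2 * b - 1" if "x \<in> missing k (odds xs)" for x
          using B(2)[OF that] by simp
        ultimately show ?thesis unfolding ball_missing * using B(1) pos by (auto simp: missing_odd[simplified] intro!: diff_le_mono)
      qed
    qed
  qed
qed

text \<open>Reflecting \<open>x\<close> to \<open>n + 1 - x\<close> for \<open>n = 2 * m\<close>
  sends \<open>2 * i\<close> to \<open>2 * (m + 1 - i) - 1\<close> and \<open>2 * j - 1\<close> to
  \<open>2 * (m + 1 - j)\<close>. Hence the even half contributes \<open>2 * a - 1\<close> and the
  odd half \<open>2 * b\<close>, the opposite of \<open>top_gap\<close>.\<close>

lemma bot_gap:
  assumes "nat_of_num n = 2 ^ k" "live k xs" "state_of k xs \<noteq> Full"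
  shows "nat_of_num (bot_gap n (state_of k xs)) \<le> 2 ^ k \<and>
    2 ^ k + 1 - nat_of_num (bot_gap n (state_of k xs)) \<in> missing k xs \<and>
    (\<forall>x\<in>missing k xs. 2 ^ k + 1 - nat_of_num (bot_gap n (state_of k xs)) \<le> x)"
  using assms
proof (induction k arbitrary: n xs)
  case 0
  then show ?case by (auto simp: nat_of_num_eq_1 missing_def split: if_splits)
next
  case (Suc k)
  obtain m where m: "n = num.Bit0 m" "nat_of_num m = 2 ^ k"
    using nat_of_num_power_Suc[OF Suc.prems(1)] .
  have l: "live k (evens xs)" "live k (odds xs)" using Suc.prems by auto
  from Suc.prems(2,3) show ?case
  proof (cases rule: state_of_Suc_cases)
    case 1
    then show ?thesis using m by (auto simp: missing_def Suc_le_eq)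
  next
    case 2
    let ?A = "state_of k (evens xs)" and ?B = "state_of k (odds xs)"
    define a where "a = nat_of_num (bot_gap m ?A)"
    define b where "b = nat_of_num (bot_gap m ?B)"
    have A: "a \<le> 2 ^ k \<and> 2 ^ k + 1 - a \<in> missing k (evens xs) \<and> (\<forall>x\<in>missing k (evens xs). 2 ^ k + 1 - a \<le> x)"
      if "?A \<noteq> Full"
      using Suc.IH[OF m(2) l(1) that] by (simp add: a_def)
    have B: "b \<le> 2 ^ k \<and> 2 ^ k + 1 - b \<in> missing k (odds xs) \<and> (\<forall>x\<in>missing k (odds xs). 2 ^ k + 1 - b \<le> x)"
      if "?B \<noteq> Full"
      using Suc.IH[OF m(2) l(2) that] by (simp add: b_def)
    have E: "missing k (evens xs) = {}" if "?A = Full" using state_of_Full_missing[OF l(1)] that by simp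
    have O: "missing k (odds xs) = {}" if "?B = Full" using state_of_Full_missing[OF l(2)] that by simp
    have pos: "0 < a" "0 < b" by (simp_all add: a_def b_def nat_of_num_pos)
    have bot: "nat_of_num (bot_gap n (state_of (Suc k) xs)) = (if ?B = Full then 2 * a - 1 else max (2 * a - 1) (2 * b))"
      unfolding 2(2) m(1) bot_gap_Split by (simp add: nat_of_num_max nat_of_num_BitM a_def b_def mult_2)
    have evn: "2 ^ Suc k + 1 - (2 * a - 1) = 2 * (2 ^ k + 1 - a)" if "a \<le> 2 ^ k"
      using that pos by simp
    have odn: "2 ^ Suc k + 1 - 2 * b = 2 * (2 ^ k + 1 - b) - 1" "0 < 2 ^ k + 1 - b" if "b \<le> 2 ^ k"
      using that pos by simp_all
    consider "?A = Full" "?B \<noteq> Full" | "?A \<noteq> Full" "?B = Full" | "?A \<noteq> Full" "?B \<noteq> Full"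
      using 2(3) by blast
    then show ?thesis
    proof cases
      case c: 1
      then have "a = 1" by (simp add: a_def bot_gap_Full)
      then have *: "nat_of_num (bot_gap n (state_of (Suc k) xs)) = 2 * b" using bot c pos by simp
      show ?thesis unfolding ball_missing * using E B c pos odn
        by (auto simp: missing_odd[simplified] intro!: diff_le_mono)
    next
      case c: 2
      then have *: "nat_of_num (bot_gap n (state_of (Suc k) xs)) = 2 * a - 1" using bot c pos by simp
      show ?thesis unfolding ball_missing * using O A c pos evn
        by (auto simp: missing_even)
    next
      case 3
      with bot have *: "nat_of_num (bot_gap n (state_of (Suc k) xs)) = max (2 * a - 1) (2 * b)" by simp
      show ?thesis
      proof (cases "a \<le> b")
        case True
        then have *: "nat_of_num (bot_gap n (state_of (Suc k) xs)) = 2 * b" using * by simp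
        have "2 ^ Suc k + 1 - 2 * b \<le> 2 * x" if "x \<in> missing k (evens xs)" for x
        proof -
          have "2 ^ k + 1 - a \<le> x" using A 3 that by blast
          then show ?thesis using True by simp
        qed
        then show ?thesis unfolding ball_missing * using B 3 pos odn by (auto simp: missing_odd[simplified] intro!: diff_le_mono)
      next
        case False
        then have *: "nat_of_num (bot_gap n (state_of (Suc k) xs)) = 2 * a - 1" using * by simp
        have "2 ^ Suc k + 1 - (2 * a - 1) \<le> 2 * x - 1" if "x \<in> missing k (odds xs)" for x
        proof -
          have "2 ^ k + 1 - b \<le> x" using B 3 that by blast
          then show ?thesis using False B 3 by simp
        qed
        then show ?thesis unfolding ball_missing * using A 3 pos evn by (auto simp: missing_even)
      qed
    qed
  qed
qed

text \<open>Reflecting either number in the other must leave \<open>[2m]\<close>. One reflection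
  falls below 1 and the other above \<open>2 * m\<close>; the two alternatives tell which of the
  numbers is the smaller one.\<close>

lemma unrelated_iff:
  assumes "1 \<le> i" "i \<le> m" "1 \<le> j" "j \<le> m"
  shows "\<not> related (2 * m) (2 * i) (2 * j - 1) \<longleftrightarrow>
    (2 * j \<le> i + 1 \<and> m + j \<le> 2 * i) \<or> (2 * i < j \<and> m + 2 + i \<le> 2 * j)"
  using assms unfolding related_def by auto

text \<open>The first alternative of \<open>unrelated_iff\<close> gets easier as \<open>i\<close>
  grows, the second as \<open>i\<close> shrinks, so only the extreme missing indices
  \<open>q = m + 1 - r\<close> and \<open>s\<close> matter. Solving their inequalities for
  \<open>j\<close> gives the values of \<open>far_limit\<close> and
  \<open>near_limit\<close>.\<close>

lemma odd_unrelated: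
  assumes M: "\<And>x. x \<in> M \<Longrightarrow> 1 \<le> x \<and> x \<le> m" and m: "even m"
    and s: "s \<in> M" "\<And>x. x \<in> M \<Longrightarrow> x \<le> s"
    and r: "r \<le> m" "m + 1 - r \<in> M" "\<And>x. x \<in> M \<Longrightarrow> m + 1 - r \<le> x"
    and j: "1 \<le> j" "j \<le> m"
  shows "(\<forall>i\<in>M. \<not> related (2 * m) (2 * i) (2 * j - 1)) \<longleftrightarrow>
    (if 2 * r \<le> m then j + max (2 * r - 1) ((m + r + 1) div 2) \<le> m + 1
     else max (2 * s + 1) ((m + s + 3) div 2) \<le> j)"
proof -
  define q where "q = m + 1 - r"
  have q: "1 \<le> q" "q \<le> m" "r + q = m + 1" "q \<in> M" "\<And>x. x \<in> M \<Longrightarrow> q \<le> x"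
    using r M[of q] by (auto simp: q_def)
  have sb: "1 \<le> s" "s \<le> m" "q \<le> s" using M s(1) q(5) by auto
  have *: "(\<forall>i\<in>M. \<not> related (2 * m) (2 * i) (2 * j - 1)) \<longleftrightarrow>
     (\<forall>i\<in>M. (2 * j \<le> i + 1 \<and> m + j \<le> 2 * i) \<or> (2 * i < j \<and> m + 2 + i \<le> 2 * j))"
    using M unrelated_iff j by (intro ball_cong) auto
  have **: "\<dots> \<longleftrightarrow> (2 * j \<le> q + 1 \<and> m + j \<le> 2 * q) \<or> (2 * s < j \<and> m + 2 + s \<le> 2 * j)"
  proof
    assume R: "\<forall>i\<in>M. (2 * j \<le> i + 1 \<and> m + j \<le> 2 * i) \<or> (2 * i < j \<and> m + 2 + i \<le> 2 * j)"
    show "(2 * j \<le> q + 1 \<and> m + j \<le> 2 * q) \<or> (2 * s < j \<and> m + 2 + s \<le> 2 * j)"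
      \<comment> \<open>\<open>q\<close> and \<open>s\<close> cannot use different alternatives: the
        first forces \<open>2 * j \<le> m + 1\<close>, the second
        \<open>2 * j \<ge> m + 2\<close>.\<close>
      using R[rule_format, OF q(4)] R[rule_format, OF s(1)] sb j by linarith
  next
    assume R: "(2 * j \<le> q + 1 \<and> m + j \<le> 2 * q) \<or> (2 * s < j \<and> m + 2 + s \<le> 2 * j)"
    show "\<forall>i\<in>M. (2 * j \<le> i + 1 \<and> m + j \<le> 2 * i) \<or> (2 * i < j \<and> m + 2 + i \<le> 2 * j)"
    proof
      fix i assume "i \<in> M"
      then have "q \<le> i" "i \<le> s" using q(5) s(2) by auto
      then show "(2 * j \<le> i + 1 \<and> m + j \<le> 2 * i) \<or> (2 * i < j \<and> m + 2 + i \<le> 2 * j)"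
        using R by linarith
    qed
  qed
  \<comment> \<open>Evenness matters: for odd \<open>m\<close> the middle index could satisfy the
    first alternative although \<open>2 * r > m\<close>.\<close>
  obtain h where h: "m = 2 * h" using m by (rule evenE)
  show ?thesis
  proof (cases "2 * r \<le> m")
    case True
    then have "\<not> (2 * s < j \<and> m + 2 + s \<le> 2 * j)" using q(3) sb j by linarith
    moreover have "2 * j \<le> q + 1 \<and> m + j \<le> 2 * q \<longleftrightarrow> j + max (2 * r - 1) ((m + r + 1) div 2) \<le> m + 1"
      using q(1-3) j True unfolding h by (auto simp: max_def)
    ultimately show ?thesis using True unfolding * ** by auto
  next
    case False
    then have "h < r" unfolding h by simp
    then have "\<not> (2 * j \<le> q + 1 \<and> m + j \<le> 2 * q)" using q(3) j unfolding h by linarith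
    moreover have "2 * s < j \<and> m + 2 + s \<le> 2 * j \<longleftrightarrow> max (2 * s + 1) ((m + s + 3) div 2) \<le> j"
      by auto
    ultimately show ?thesis using False unfolding * ** by auto
  qed
qed

text \<open>The mirror image of \<open>odd_unrelated\<close>: sending \<open>v\<close> to
  \<open>2 * m + 1 - v\<close> preserves \<open>related\<close>, exchanges evens and odds, and swaps
  the roles of \<open>s\<close> and \<open>r\<close>.\<close>

lemma even_unrelated:
  assumes M: "\<And>x. x \<in> M \<Longrightarrow> 1 \<le> x \<and> x \<le> m" and m: "even m"
    and s: "s \<in> M" "\<And>x. x \<in> M \<Longrightarrow> x \<le> s"
    and r: "r \<le> m" "m + 1 - r \<in> M" "\<And>x. x \<in> M \<Longrightarrow> m + 1 - r \<le> x"
    and i: "1 \<le> i" "i \<le> m"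
  shows "(\<forall>j\<in>M. \<not> related (2 * m) (2 * j - 1) (2 * i)) \<longleftrightarrow>
    (if 2 * s \<le> m then max (2 * s - 1) ((m + s + 1) div 2) \<le> i
     else i + max (2 * r + 1) ((m + r + 3) div 2) \<le> m + 1)"
proof -
  let ?f = "\<lambda>x. m + 1 - x"
  have inv: "m + 1 - s \<in> ?f ` M" "?f (?f x) = x" if "x \<in> M" for x
    using s M[OF that] by auto
  have rel: "related (2 * m) (2 * j - 1) (2 * i) \<longleftrightarrow> related (2 * m) (2 * ?f j) (2 * ?f i - 1)"
    if "1 \<le> j" "j \<le> m" for j
    using that i unfolding related_def by auto
  have "(\<forall>j\<in>M. \<not> related (2 * m) (2 * j - 1) (2 * i)) \<longleftrightarrow>
     (\<forall>j\<in>?f ` M. \<not> related (2 * m) (2 * j) (2 * ?f i - 1))"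
    using rel M by auto
  also have "\<dots> \<longleftrightarrow> (if 2 * s \<le> m then ?f i + max (2 * s - 1) ((m + s + 1) div 2) \<le> m + 1
     else max (2 * r + 1) ((m + r + 3) div 2) \<le> ?f i)"
  proof (rule odd_unrelated)
    show "m + 1 - s \<in> ?f ` M" using s(1) by blast
    show "r \<in> ?f ` M" using r by (intro image_eqI[of _ _ "m + 1 - r"]) auto
    show "x \<le> r" if "x \<in> ?f ` M" for x using that r(1,3) by fastforce
    show "m + 1 - s \<le> x" if "x \<in> ?f ` M" for x using that s(2) by fastforce
    show "1 \<le> x \<and> x \<le> m" if "x \<in> ?f ` M" for x using that M by fastforce
  qed (use M s i m in auto)
  also have "\<dots> \<longleftrightarrow> (if 2 * s \<le> m then max (2 * s - 1) ((m + s + 1) div 2) \<le> i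
     else i + max (2 * r + 1) ((m + r + 3) div 2) \<le> m + 1)"
    using i by auto
  finally show ?thesis .
qed

section \<open>The successor list against the admissible next elements\<close>

lemma sum_split_parity:
  fixes f :: "nat \<Rightarrow> nat"
  assumes "finite V" "0 \<notin> V"
  shows "(\<Sum>v\<in>V. f v) = (\<Sum>i | 2 * i \<in> V. f (2 * i)) + (\<Sum>j | 0 < j \<and> 2 * j - 1 \<in> V. f (2 * j - 1))"
proof -
  let ?E = "{i. 2 * i \<in> V}" and ?O = "{j. 0 < j \<and> 2 * j - 1 \<in> V}"
  have V: "V = (\<lambda>i. 2 * i) ` ?E \<union> (\<lambda>j. 2 * j - 1) ` ?O"
  proof (intro set_eqI iffI)
    fix v assume "v \<in> V"
    then show "v \<in> (\<lambda>i. 2 * i) ` ?E \<union> (\<lambda>j. 2 * j - 1) ` ?O"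
      by (cases v rule: nat_halves_cases) auto
  qed auto
  have inj: "inj_on (\<lambda>i. 2 * i) ?E" "inj_on (\<lambda>j. 2 * j - 1) ?O"
    by (auto simp: inj_on_def)
  have "2 * i \<noteq> 2 * j - 1" if "0 < j" for i j :: nat
    using that by presburger
  then have disj: "(\<lambda>i. 2 * i) ` ?E \<inter> (\<lambda>j. 2 * j - 1) ` ?O = {}" by blast
  have fin: "finite ((\<lambda>i. 2 * i) ` ?E)" "finite ((\<lambda>j. 2 * j - 1) ` ?O)"
    by (rule finite_subset[OF _ assms(1)]; auto)+
  have "sum f V = sum f ((\<lambda>i. 2 * i) ` ?E \<union> (\<lambda>j. 2 * j - 1) ` ?O)"
    by (rule arg_cong[OF V])
  also have "\<dots> = sum f ((\<lambda>i. 2 * i) ` ?E) + sum f ((\<lambda>j. 2 * j - 1) ` ?O)"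
    by (rule sum.union_disjoint[OF fin disj])
  finally have "sum f V = sum f ((\<lambda>i. 2 * i) ` ?E) + sum f ((\<lambda>j. 2 * j - 1) ` ?O)" .
  then show ?thesis unfolding sum.reindex[OF inj(1)] sum.reindex[OF inj(2)] o_def .
qed

lemma sum_join_left:
  fixes g :: "state \<Rightarrow> nat"
  shows "(\<Sum>T\<leftarrow>join_left b B As Ss. g T) = (\<Sum>A\<leftarrow>As. g (join b A B)) + (\<Sum>T\<leftarrow>Ss. g T)"
  by (induction As) auto

lemma sum_join_right:
  fixes g :: "state \<Rightarrow> nat"
  shows "(\<Sum>T\<leftarrow>join_right b A Bs. g T) = (\<Sum>B\<leftarrow>Bs. g (join b A B))"
  by (induction Bs) auto

lemma live_finite: "finite {v. live k (xs @ [v]) \<and> P v}"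
  by (rule finite_subset[of _ "{1..2 ^ k}"]) (auto dest: live_subset)

lemma live_snoc_pos: "live k (xs @ [v]) \<Longrightarrow> 1 \<le> v \<and> v \<le> 2 ^ k"
  by (auto dest: live_subset)

lemma half_ordered_ball_missing:
  "(\<forall>w\<in>{1..2 ^ Suc k}. even w = b \<longrightarrow> related n w v \<longrightarrow> w \<in> set xs) \<longleftrightarrow>
     (if b then \<forall>i\<in>missing k (evens xs). \<not> related n (2 * i) v
      else \<forall>j\<in>missing k (odds xs). \<not> related n (2 * j - 1) v)"
proof -
  have "(\<forall>w\<in>{1..2 ^ Suc k}. even w = b \<longrightarrow> related n w v \<longrightarrow> w \<in> set xs) \<longleftrightarrow>
     (\<forall>w\<in>missing (Suc k) xs. even w = b \<longrightarrow> \<not> related n w v)"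
    unfolding missing_def by blast
  also have "\<dots> \<longleftrightarrow> (if b then \<forall>i\<in>missing k (evens xs). \<not> related n (2 * i) v
      else \<forall>j\<in>missing k (odds xs). \<not> related n (2 * j - 1) v)"
  proof -
    have "odd (2 * j - 1)" if "j \<in> missing k (odds xs)" for j
      using missing_pos[OF that] by simp
    then show ?thesis unfolding ball_missing by auto
  qed
  finally show ?thesis .
qed

text \<open>An entry advances only its own half, and the order condition binds only the half that
  does not lead. For \<open>xs = []\<close> the entry itself fixes the leader and is free.\<close>

lemma live_snoc_even:
  assumes "live (Suc k) xs"
  shows "live (Suc k) (xs @ [2 * i]) \<longleftrightarrow> live k (evens xs @ [i]) \<and>
    (xs \<noteq> [] \<and> odd (hd xs) \<longrightarrow> (\<forall>j\<in>missing k (odds xs). \<not> related (2 ^ Suc k) (2 * j - 1) (2 * i)))"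
  using assms half_ordered_ball_missing[of k False "2 ^ Suc k" "2 * i" xs]
  by (cases "xs = []") (auto simp: evens_append odds_append evens_single odds_single half_ordered_snoc
      half_ordered_snoc[of _ _ "[]", simplified])

lemma live_snoc_odd:
  assumes "live (Suc k) xs" "0 < j"
  shows "live (Suc k) (xs @ [2 * j - 1]) \<longleftrightarrow> live k (odds xs @ [j]) \<and>
    (xs \<noteq> [] \<and> even (hd xs) \<longrightarrow> (\<forall>i\<in>missing k (evens xs). \<not> related (2 ^ Suc k) (2 * i) (2 * j - 1)))"
proof -
  have "odd (2 * j - 1)" "Suc (2 * j - 1) div 2 = j" using assms(2) by auto
  then show ?thesis
    using assms half_ordered_ball_missing[of k True "2 ^ Suc k" "2 * j - 1" xs]
    by (cases "xs = []") (auto simp: evens_append odds_append evens_single odds_single half_ordered_snoc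
        half_ordered_snoc[of _ _ "[]", simplified])
qed

lemma odd_bounds:
  assumes m: "nat_of_num m = 2 ^ k" and es: "live k es" "es \<noteq> []" and j: "1 \<le> j" "j \<le> 2 ^ k"
  defines "S \<equiv> state_of k es"
  shows "nat_of_num (num_max lo (near_bound m S (bot_gap m S) (top_gap m S))) \<le> j \<and>
      j + nat_of_num (num_max hi (far_bound m S (bot_gap m S))) \<le> 2 ^ k + 1 \<longleftrightarrow>
    nat_of_num lo \<le> j \<and> j + nat_of_num hi \<le> 2 ^ k + 1 \<and>
      (\<forall>i\<in>missing k es. \<not> related (2 ^ Suc k) (2 * i) (2 * j - 1))"
proof (cases "S = Full")
  case True
  then have "missing k es = {}" using state_of_Full_missing[OF es(1)] by (simp add: S_def)
  then show ?thesis using True j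
    by (auto simp: nat_of_num_max far_bound_if near_bound_if)
next
  case False
  note top = top_gap[OF m es(1) False[unfolded S_def], folded S_def]
  note bot = bot_gap[OF m es(1) False[unfolded S_def], folded S_def]
  \<comment> \<open>For \<open>k = 0\<close> a nonempty word is already \<open>Full\<close>; hence
    \<open>2 ^ k\<close> is even, as \<open>odd_unrelated\<close> requires.\<close>
  have "k \<noteq> 0"
    using es False by (auto simp: S_def intro!: Nat.gr0I)
  then have "even (2 ^ k :: nat)" by simp
  note iff = odd_unrelated[where M = "missing k es", OF _ this _ _ _ _ _ j]
  have "(\<forall>i\<in>missing k es. \<not> related (2 * 2 ^ k) (2 * i) (2 * j - 1)) \<longleftrightarrow>
    (if 2 * nat_of_num (bot_gap m S) \<le> 2 ^ k
     then j + max (2 * nat_of_num (bot_gap m S) - 1) ((2 ^ k + nat_of_num (bot_gap m S) + 1) div 2) \<le> 2 ^ k + 1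
     else max (2 * nat_of_num (top_gap m S) + 1) ((2 ^ k + nat_of_num (top_gap m S) + 3) div 2) \<le> j)"
    using top bot missing_pos by (intro iff) (auto simp: Suc_le_eq)
  then show ?thesis using False j
    by (auto simp: nat_of_num_max far_bound_if near_bound_if nat_of_num_far_limit nat_of_num_near_limit m)
qed

lemma even_bounds:
  assumes m: "nat_of_num m = 2 ^ k" and os: "live k os" "os \<noteq> []" and i: "1 \<le> i" "i \<le> 2 ^ k"
  defines "S \<equiv> state_of k os"
  shows "nat_of_num (num_max lo (far_bound m S (top_gap m S))) \<le> i \<and>
      i + nat_of_num (num_max hi (near_bound m S (top_gap m S) (bot_gap m S))) \<le> 2 ^ k + 1 \<longleftrightarrow>
    nat_of_num lo \<le> i \<and> i + nat_of_num hi \<le> 2 ^ k + 1 \<and>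
      (\<forall>j\<in>missing k os. \<not> related (2 ^ Suc k) (2 * j - 1) (2 * i))"
proof (cases "S = Full")
  case True
  then have "missing k os = {}" using state_of_Full_missing[OF os(1)] by (simp add: S_def)
  then show ?thesis using True i
    by (auto simp: nat_of_num_max far_bound_if near_bound_if)
next
  case False
  note top = top_gap[OF m os(1) False[unfolded S_def], folded S_def]
  note bot = bot_gap[OF m os(1) False[unfolded S_def], folded S_def]
  have "k \<noteq> 0"
    using os False by (auto simp: S_def intro!: Nat.gr0I)
  then have "even (2 ^ k :: nat)" by simp
  note iff = even_unrelated[where M = "missing k os", OF _ this _ _ _ _ _ i]
  have "(\<forall>j\<in>missing k os. \<not> related (2 * 2 ^ k) (2 * j - 1) (2 * i)) \<longleftrightarrow>
    (if 2 * nat_of_num (top_gap m S) \<le> 2 ^ k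
     then max (2 * nat_of_num (top_gap m S) - 1) ((2 ^ k + nat_of_num (top_gap m S) + 1) div 2) \<le> i
     else i + max (2 * nat_of_num (bot_gap m S) + 1) ((2 ^ k + nat_of_num (bot_gap m S) + 3) div 2) \<le> 2 ^ k + 1)"
    using top bot missing_pos by (intro iff) (auto simp: Suc_le_eq)
  then show ?thesis using False i
    by (auto simp: nat_of_num_max far_bound_if near_bound_if nat_of_num_far_limit nat_of_num_near_limit m)
qed

lemma state_of_snoc_even:
  assumes "live (Suc k) (xs @ [2 * i])"
  shows "state_of (Suc k) (xs @ [2 * i]) =
    join (xs = [] \<or> even (hd xs)) (state_of k (evens xs @ [i])) (state_of k (odds xs))"
  using state_of_join[OF assms]
  by (cases "xs = []") (auto simp: evens_append odds_append evens_single odds_single)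

lemma state_of_snoc_odd:
  assumes "live (Suc k) (xs @ [2 * j - 1])" "0 < j"
  shows "state_of (Suc k) (xs @ [2 * j - 1]) =
    join (xs \<noteq> [] \<and> even (hd xs)) (state_of k (evens xs)) (state_of k (odds xs @ [j]))"
proof -
  have "odd (2 * j - 1)" "Suc (2 * j - 1) div 2 = j" using assms(2) by auto
  then show ?thesis
    using state_of_join[OF assms(1)]
    by (cases "xs = []") (auto simp: evens_append odds_append evens_single odds_single)
qed

text \<open>A number \<open>v\<close> with \<open>lo \<le> v\<close> and
  \<open>v + hi \<le> n + 1\<close> exists exactly if \<open>lo + hi \<le> n + 1\<close>; the guard
  cuts off empty ranges.\<close>

lemma moves_guard: "moves n lo hi S = (if lo + hi \<le> Num.inc n then moves_if True n lo hi S else [])"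
  by simp

text \<open>Summing an arbitrary \<open>g\<close> expresses that successors and admissible elements
  agree with multiplicity, without naming a bijection. The induction needs \<open>g\<close>
  arbitrary: on a half it is applied to \<open>g\<close> composed with \<open>join\<close>.\<close>

lemma moves_sum:
  fixes g :: "state \<Rightarrow> nat"
  assumes "nat_of_num n = 2 ^ k" "live k xs"
  shows "(\<Sum>T\<leftarrow>moves n lo hi (state_of k xs). g T) =
    (\<Sum>v | live k (xs @ [v]) \<and> nat_of_num lo \<le> v \<and> v + nat_of_num hi \<le> 2 ^ k + 1.
       g (state_of k (xs @ [v])))"
  using assms
proof (induction k arbitrary: n xs lo hi g)
  case 0
  then have n: "n = num.One" using nat_of_num_eq_1 by simp
  consider "xs = []" | "xs = [1]" using 0 by auto
  then show ?case
  proof cases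
    case 1
    have *: "{v. live 0 (xs @ [v]) \<and> nat_of_num lo \<le> v \<and> v + nat_of_num hi \<le> 2 ^ 0 + 1} =
      (if lo + hi \<le> Num.inc n then {1} else {})"
      using nat_of_num_pos[of lo] nat_of_num_pos[of hi] 1
      by (auto simp: n less_eq_num_def nat_of_num_add nat_of_num_inc)
    show ?thesis unfolding * moves_guard by (simp add: n 1)
  next
    case 2
    then show ?thesis by (simp add: n moves_guard del: moves.simps)
  qed
next
  case (Suc k)
  obtain m where m: "n = num.Bit0 m" "nat_of_num m = 2 ^ k"
    using nat_of_num_power_Suc[OF Suc.prems(1)] .
  have l: "live k (evens xs)" "live k (odds xs)" using Suc.prems by auto
  let ?M = "2 ^ k :: nat"
  let ?A = "state_of k (evens xs)" and ?B = "state_of k (odds xs)"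
  define V where "V = {v. live (Suc k) (xs @ [v]) \<and> nat_of_num lo \<le> v \<and> v + nat_of_num hi \<le> 2 ^ Suc k + 1}"
  have V: "finite V" "0 \<notin> V"
    using live_finite[of "Suc k" xs] live_snoc_pos[of "Suc k" xs 0] by (auto simp: V_def)
  show ?case
  proof (cases "lo + hi \<le> Num.inc n")
    case False
    then have "V = {}"
      by (auto simp: V_def less_eq_num_def nat_of_num_add nat_of_num_inc Suc.prems(1))
    with False show ?thesis unfolding V_def[symmetric] moves_guard by simp
  next
    case guard: True
    have even_range: "nat_of_num lo \<le> 2 * i \<and> 2 * i + nat_of_num hi \<le> 2 ^ Suc k + 1 \<longleftrightarrow>
        nat_of_num (half_up lo) \<le> i \<and> i + nat_of_num (half_Suc hi) \<le> ?M + 1" for i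
      by (auto simp: nat_of_num_half_up nat_of_num_half_Suc)
    have odd_range: "nat_of_num lo \<le> 2 * j - 1 \<and> 2 * j - 1 + nat_of_num hi \<le> 2 ^ Suc k + 1 \<longleftrightarrow>
        nat_of_num (half_Suc lo) \<le> j \<and> j + nat_of_num (half_up hi) \<le> ?M + 1" if "0 < j" for j
      using that by (auto simp: nat_of_num_half_up nat_of_num_half_Suc)
    have evenV: "2 * i \<in> V \<longleftrightarrow> live k (evens xs @ [i]) \<and>
        (nat_of_num (half_up lo) \<le> i \<and> i + nat_of_num (half_Suc hi) \<le> ?M + 1) \<and>
        (xs \<noteq> [] \<and> odd (hd xs) \<longrightarrow> (\<forall>j\<in>missing k (odds xs). \<not> related (2 ^ Suc k) (2 * j - 1) (2 * i)))" for i
      unfolding V_def mem_Collect_eq even_range live_snoc_even[OF Suc.prems(2)] by blast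
    have oddV: "0 < j \<and> 2 * j - 1 \<in> V \<longleftrightarrow> live k (odds xs @ [j]) \<and>
        (nat_of_num (half_Suc lo) \<le> j \<and> j + nat_of_num (half_up hi) \<le> ?M + 1) \<and>
        (xs \<noteq> [] \<and> even (hd xs) \<longrightarrow> (\<forall>i\<in>missing k (evens xs). \<not> related (2 ^ Suc k) (2 * i) (2 * j - 1)))" for j
    proof (cases "0 < j")
      case True
      then show ?thesis
        unfolding V_def mem_Collect_eq odd_range[OF True] live_snoc_odd[OF Suc.prems(2) True] by blast
    next
      case False
      then show ?thesis using live_snoc_pos[of k "odds xs" j] by auto
    qed
    \<comment> \<open>The flags after reading an even or an odd element. They differ only for
      \<open>xs = []\<close>, where the new entry decides who leads.\<close>
    define b where "b \<longleftrightarrow> xs = [] \<or> even (hd xs)"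
    define c where "c \<longleftrightarrow> xs \<noteq> [] \<and> even (hd xs)"
    have "(\<Sum>v\<in>V. g (state_of (Suc k) (xs @ [v]))) =
        (\<Sum>i | 2 * i \<in> V. g (state_of (Suc k) (xs @ [2 * i]))) +
        (\<Sum>j | 0 < j \<and> 2 * j - 1 \<in> V. g (state_of (Suc k) (xs @ [2 * j - 1])))"
      by (rule sum_split_parity[OF V])
    also have "(\<Sum>i | 2 * i \<in> V. g (state_of (Suc k) (xs @ [2 * i]))) =
        (\<Sum>i | 2 * i \<in> V. g (join b (state_of k (evens xs @ [i])) ?B))"
      unfolding b_def by (intro sum.cong refl arg_cong[of _ _ g] state_of_snoc_even) (simp add: V_def)
    also have "(\<Sum>j | 0 < j \<and> 2 * j - 1 \<in> V. g (state_of (Suc k) (xs @ [2 * j - 1]))) =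
        (\<Sum>j | 0 < j \<and> 2 * j - 1 \<in> V. g (join c ?A (state_of k (odds xs @ [j]))))"
      unfolding c_def by (intro sum.cong refl arg_cong[of _ _ g] state_of_snoc_odd) (auto simp: V_def)
    finally have sumV: "(\<Sum>v\<in>V. g (state_of (Suc k) (xs @ [v]))) =
        (\<Sum>i | 2 * i \<in> V. g (join b (state_of k (evens xs @ [i])) ?B)) +
        (\<Sum>j | 0 < j \<and> 2 * j - 1 \<in> V. g (join c ?A (state_of k (odds xs @ [j]))))" .
    \<comment> \<open>The part common to a first move and to both kinds of leader: these cases
      differ only in the bounds handed down to the halves.\<close>
    have sum_moves: "(\<Sum>T\<leftarrow>moves n lo hi (state_of (Suc k) xs). g T) = (\<Sum>v\<in>V. g (state_of (Suc k) (xs @ [v])))"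
      if mv: "moves_if True n lo hi (state_of (Suc k) xs) =
          join_left b ?B (moves m lo1 hi1 ?A) (join_right c ?A (moves m lo2 hi2 ?B))"
        and e: "\<And>i. 2 * i \<in> V \<longleftrightarrow> live k (evens xs @ [i]) \<and> nat_of_num lo1 \<le> i \<and> i + nat_of_num hi1 \<le> ?M + 1"
        and o: "\<And>j. 0 < j \<and> 2 * j - 1 \<in> V \<longleftrightarrow> live k (odds xs @ [j]) \<and> nat_of_num lo2 \<le> j \<and> j + nat_of_num hi2 \<le> ?M + 1"
      for lo1 hi1 lo2 hi2
      unfolding sumV moves_guard[of n] mv e o using guard
      by (simp add: sum_join_left sum_join_right Suc.IH[OF m(2) l(1)] Suc.IH[OF m(2) l(2)] del: moves.simps)
    consider "xs = []" | "state_of (Suc k) xs = Full" | "xs \<noteq> []" "state_of (Suc k) xs \<noteq> Full" by blast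
    then have "(\<Sum>T\<leftarrow>moves n lo hi (state_of (Suc k) xs). g T) = (\<Sum>v\<in>V. g (state_of (Suc k) (xs @ [v])))"
    proof cases
      case 1
      show ?thesis
      proof (rule sum_moves)
        show "moves_if True n lo hi (state_of (Suc k) xs) =
          join_left b ?B (moves m (half_up lo) (half_Suc hi) ?A) (join_right c ?A (moves m (half_Suc lo) (half_up hi) ?B))"
          using 1 by (simp add: m(1) b_def c_def del: moves.simps)
      qed (use evenV oddV 1 in auto)
    next
      case 2
      then have "length xs = 2 ^ Suc k" using state_of_Full[OF Suc.prems(2)] by blast
      then have "V = {}" using live_length_le[of "Suc k" "xs @ [v]" for v] by (fastforce simp: V_def)
      then show ?thesis unfolding moves_guard[of n] 2 by simp
    next
      case 3
      then have split: "state_of (Suc k) xs = Split (even (hd xs)) ?A ?B"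
        by (auto elim: state_of_Suc_cases[OF Suc.prems(2)])
      have hd: "hd xs \<in> set xs" using 3(1) by simp
      show ?thesis
      proof (cases "even (hd xs)")
        case True
        then have ne: "evens xs \<noteq> []" using hd by (auto simp: evens_def filter_empty_conv)
        show ?thesis
        proof (rule sum_moves)
          show "moves_if True n lo hi (state_of (Suc k) xs) =
            join_left b ?B (moves m (half_up lo) (half_Suc hi) ?A)
              (join_right c ?A (moves m (num_max (half_Suc lo) (near_bound m ?A (bot_gap m ?A) (top_gap m ?A)))
                (num_max (half_up hi) (far_bound m ?A (bot_gap m ?A))) ?B))"
            unfolding split using True 3(1) by (simp add: m(1) b_def c_def del: moves.simps)
          fix j
          show "0 < j \<and> 2 * j - 1 \<in> V \<longleftrightarrow> live k (odds xs @ [j]) \<and>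
            nat_of_num (num_max (half_Suc lo) (near_bound m ?A (bot_gap m ?A) (top_gap m ?A))) \<le> j \<and>
            j + nat_of_num (num_max (half_up hi) (far_bound m ?A (bot_gap m ?A))) \<le> ?M + 1"
            unfolding oddV
            using odd_bounds[OF m(2) l(1) ne, of j "half_Suc lo" "half_up hi"] live_snoc_pos[of k "odds xs" j] True 3(1)
            by blast
        qed (use evenV True in auto)
      next
        case False
        then have ne: "odds xs \<noteq> []" using hd by (auto simp: odds_def filter_empty_conv)
        show ?thesis
        proof (rule sum_moves)
          show "moves_if True n lo hi (state_of (Suc k) xs) =
            join_left b ?B (moves m (num_max (half_up lo) (far_bound m ?B (top_gap m ?B)))
                (num_max (half_Suc hi) (near_bound m ?B (top_gap m ?B) (bot_gap m ?B))) ?A)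
              (join_right c ?A (moves m (half_Suc lo) (half_up hi) ?B))"
            unfolding split using False 3(1) by (simp add: m(1) b_def c_def del: moves.simps)
          fix i
          show "2 * i \<in> V \<longleftrightarrow> live k (evens xs @ [i]) \<and>
            nat_of_num (num_max (half_up lo) (far_bound m ?B (top_gap m ?B))) \<le> i \<and>
            i + nat_of_num (num_max (half_Suc hi) (near_bound m ?B (top_gap m ?B) (bot_gap m ?B))) \<le> ?M + 1"
            unfolding evenV
            using even_bounds[OF m(2) l(2) ne, of i "half_up lo" "half_Suc hi"] live_snoc_pos[of k "evens xs" i] False 3(1)
            by blast
        qed (use oddV False in auto)
      qed
    qed
    then show ?thesis unfolding V_def .
  qed
qed

section \<open>Counting\<close>

text \<open>Every state counts as final: a live word of length \<open>2 ^ k\<close> already uses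
  each element of \<open>[2^k]\<close> (\<open>live_full\<close>).\<close>

fun completions :: "num \<Rightarrow> nat \<Rightarrow> state \<Rightarrow> nat" where
  "completions n 0 S = 1"
| "completions n (Suc r) S = (\<Sum>T\<leftarrow>moves n num.One num.One S. completions n r T)"

lemma half_ordered_prefix: "half_ordered b n (xs @ ys) \<Longrightarrow> half_ordered b n xs"
  by (induction ys rule: rev_induct) (auto simp: half_ordered_snoc simp flip: append_assoc)

lemma live_prefix: "live k (xs @ ys) \<Longrightarrow> live k xs"
proof (induction k arbitrary: xs ys)
  case 0
  then show ?case by (cases xs) auto
next
  case (Suc k)
  then show ?case
    by (cases "xs = []") (auto simp: evens_append odds_append dest: half_ordered_prefix)
qed

lemma finite_live_extensions: "finite {ys. length ys = r \<and> live k (xs @ ys)}"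
proof (rule finite_subset)
  show "{ys. length ys = r \<and> live k (xs @ ys)} \<subseteq> {ys. set ys \<subseteq> {1..2 ^ k} \<and> length ys = r}"
    using live_subset[of k "xs @ ys" for ys] by fastforce
qed (simp add: finite_lists_length_eq)

lemma card_live_extensions:
  assumes n: "nat_of_num n = 2 ^ k"
  shows "live k xs \<Longrightarrow> card {ys. length ys = r \<and> live k (xs @ ys)} = completions n r (state_of k xs)"
proof (induction r arbitrary: xs)
  case 0
  then have "{ys. length ys = 0 \<and> live k (xs @ ys)} = {[]}" by auto
  then show ?case by (simp only: completions.simps card.empty card_insert_disjoint finite.emptyI empty_iff not_False_eq_True One_nat_def)
next
  case (Suc r)
  let ?V = "{v. live k (xs @ [v]) \<and> nat_of_num num.One \<le> v \<and> v + nat_of_num num.One \<le> 2 ^ k + 1}"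
  let ?Y = "\<lambda>v. {ys. length ys = r \<and> live k ((xs @ [v]) @ ys)}"
  have "{ys. length ys = Suc r \<and> live k (xs @ ys)} = (\<Union>v\<in>?V. (#) v ` ?Y v)"
  proof (intro set_eqI iffI)
    fix ys assume "ys \<in> {ys. length ys = Suc r \<and> live k (xs @ ys)}"
    then obtain v zs where ys: "ys = v # zs" "length zs = r" "live k (xs @ v # zs)"
      by (auto simp: length_Suc_conv)
    then have "live k (xs @ [v])" using live_prefix[of k "xs @ [v]" zs] by simp
    then have "v \<in> ?V" using live_snoc_pos by fastforce
    with ys show "ys \<in> (\<Union>v\<in>?V. (#) v ` ?Y v)" by force
  qed auto
  moreover have "card (\<Union>v\<in>?V. (#) v ` ?Y v) = (\<Sum>v\<in>?V. card ((#) v ` ?Y v))"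
  proof (rule card_UN_disjoint)
    show "finite ?V" by (rule live_finite)
    show "\<forall>v\<in>?V. finite ((#) v ` ?Y v)" using finite_live_extensions by blast
  qed auto
  moreover have "card ((#) v ` ?Y v) = completions n r (state_of k (xs @ [v]))" if "v \<in> ?V" for v
    using that Suc.IH[of "xs @ [v]"] by (simp add: card_image)
  ultimately show ?case
    using moves_sum[OF n Suc.prems, of "completions n r" num.One num.One] by simp
qed

lemma live_iff_three_free:
  "distinct xs \<Longrightarrow> set xs = {1..2 ^ k} \<Longrightarrow> live k xs \<longleftrightarrow> three_free xs"
proof (induction k arbitrary: xs)
  case 0
  then have "length xs = 1" using distinct_card[of xs] by simp
  then obtain a where "xs = [a]" by (cases xs) auto
  with 0 have "xs = [1]" by simp
  then show ?case by (auto simp: three_free_def)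
next
  case (Suc k)
  have "set (evens xs) = {1..2 ^ k}" "set (odds xs) = {1..2 ^ k}"
    unfolding set_eq_iff set_evens set_odds Suc.prems(2) by auto
  moreover have "distinct (evens xs)" "distinct (odds xs)"
    using Suc.prems(1) distinct_evens_odds by blast+
  ultimately show ?case
    using three_free_iff_halves[OF Suc.prems] Suc.IH by simp
qed

lemma theta_power_two:
  assumes "nat_of_num n = 2 ^ k"
  shows "theta (2 ^ k) = completions n (2 ^ k) Empty"
proof -
  have "{a \<in> permutations_of_set {1..2 ^ k}. three_free a} = {ys. length ys = 2 ^ k \<and> live k ([] @ ys)}"
  proof (intro set_eqI iffI)
    fix a assume "a \<in> {a \<in> permutations_of_set {1..2 ^ k}. three_free a}"
    then have a: "distinct a" "set a = {1..2 ^ k}" "three_free a" by (auto simp: permutations_of_set_def)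
    then have "length a = 2 ^ k" using distinct_card[of a] by simp
    then show "a \<in> {ys. length ys = 2 ^ k \<and> live k ([] @ ys)}" using live_iff_three_free a by simp
  next
    fix a assume "a \<in> {ys. length ys = 2 ^ k \<and> live k ([] @ ys)}"
    then have a: "live k a" "length a = 2 ^ k" by auto
    then have "missing k a = {}" using live_full by blast
    then have "set a = {1..2 ^ k}" using live_subset[OF a(1)] by (auto simp: missing_def)
    then show "a \<in> {a \<in> permutations_of_set {1..2 ^ k}. three_free a}"
      using live_iff_three_free[of a k] live_distinct[OF a(1)] a(1) by (auto simp: permutations_of_set_def)
  qed
  then show ?thesis
    unfolding theta_def using card_live_extensions[OF assms, of "[]" "2 ^ k"] by simp
qed

section \<open>Correctness of the layer by layer count\<close>

definition weight :: "(state \<Rightarrow> nat) \<Rightarrow> layer \<Rightarrow> nat" where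
  "weight f L = (\<Sum>(S, c)\<leftarrow>L. nat_of_num c * f S)"

lemma weight_simps [simp]:
  "weight f [] = 0" "weight f (x # L) = nat_of_num (snd x) * f (fst x) + weight f L"
  by (auto simp: weight_def split_beta)

text \<open>The counts stay correct because only equal states are ever merged; the order serves to
  find them quickly.\<close>

lemma cmp_Eq: "cmp S T = Eq \<Longrightarrow> S = T"
  and "cmp_then c S T = Eq \<Longrightarrow> c = Eq \<and> S = T"
  by (induction S T and c S T rule: cmp_cmp_then.induct) auto

lemma weight_merge: "weight f (merge xs ys) = weight f xs + weight f ys"
  and "(c = Eq \<Longrightarrow> fst x = fst y) \<Longrightarrow>
    weight f (merge_by c x xs y ys) = weight f (x # xs) + weight f (y # ys)"
  by (induction xs ys and c x xs y ys rule: merge_merge_by.induct)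
    (auto simp: nat_of_num_add algebra_simps dest: cmp_Eq)

lemma weight_merge_pairs: "(\<Sum>L\<leftarrow>merge_pairs Ls. weight f L) = (\<Sum>L\<leftarrow>Ls. weight f L)"
  by (induction Ls rule: merge_pairs.induct) (auto simp: weight_merge)

lemma weight_merge_all: "weight f (merge_all Ls) = (\<Sum>L\<leftarrow>Ls. weight f L)"
  by (induction Ls rule: merge_all.induct) (auto simp: weight_merge weight_merge_pairs)

lemma weight_tag: "(\<Sum>L\<leftarrow>tag c Ss Ls. weight f L) = nat_of_num c * (\<Sum>S\<leftarrow>Ss. f S) + (\<Sum>L\<leftarrow>Ls. weight f L)"
  by (induction c Ss Ls rule: tag.induct) (auto simp: algebra_simps)

text \<open>The invariant of the count: pairing the number of ways to reach a state with its number
  of completions gives the same total before and after a step, one step passing from the completions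
  to the layer.\<close>

lemma weight_next_layer: "weight (completions n r) (next_layer n L) = weight (completions n (Suc r)) L"
  unfolding next_layer_def weight_merge_all
  by (induction n L rule: expand.induct) (auto simp: weight_tag simp del: moves.simps)

lemma weight_iter_layer:
  "weight (completions n r) (iter_layer n k L) = weight (completions n (r + nat_of_num k)) L"
  by (induction n k L arbitrary: r rule: iter_layer.induct) (simp_all add: weight_next_layer add.assoc)

fun total :: "layer \<Rightarrow> nat" where
  "total [] = 0"
| "total ((S, c) # L) = numeral c + total L"

lemma theta_eq_total:
  assumes "nat_of_num n = 2 ^ k"
  shows "theta (2 ^ k) = total (iter_layer n n [(Empty, num.One)])"
proof -
  have "total L = weight (completions n 0) L" for L
    by (induction L rule: total.induct) (auto simp: nat_of_num_numeral)
  then show ?thesis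
    using weight_iter_layer[of n 0 n "[(Empty, num.One)]"] theta_power_two[OF assms] by (simp add: assms)
qed

lemma total_layer_64:
  "total (iter_layer (num.Bit0 (num.Bit0 (num.Bit0 (num.Bit0 (num.Bit0 (num.Bit0 num.One))))))
     (num.Bit0 (num.Bit0 (num.Bit0 (num.Bit0 (num.Bit0 (num.Bit0 num.One)))))) [(Empty, num.One)]) =
   39911512393313043466768"
  \<comment> \<open>The whole run through 64 layers is proved here by rewriting. All full words end
    in \<open>Full\<close>, so the last layer is a single entry and \<open>total\<close> only has to
    add 0.\<close>
  by (simp only: layer_eval total.simps add_0_right)

lemma theta_64: "theta 64 = 39911512393313043466768"
  using theta_eq_total[of "num.Bit0 (num.Bit0 (num.Bit0 (num.Bit0 (num.Bit0 (num.Bit0 num.One)))))" 6]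
  unfolding total_layer_64 by (simp add: nat_of_num_numeral)

section \<open>Doubling\<close>

text \<open>The ends of a progression have an even sum, so they cannot lie in different parts, and
  with both ends in one part the middle lies there too.\<close>

lemma three_free_append:
  assumes "three_free us" "three_free vs" "\<And>x z. x \<in> set us \<Longrightarrow> z \<in> set vs \<Longrightarrow> odd (x + z)"
  shows "three_free (us @ vs)"
  unfolding three_free_def
proof clarify
  fix i j k assume ijk: "i < j" "j < k" "k < length (us @ vs)"
    and ap: "(us @ vs) ! i + (us @ vs) ! k = 2 * (us @ vs) ! j"
  consider "k < length us" | "length us \<le> i" | "i < length us" "length us \<le> k" by linarith
  then show False
  proof cases
    case 1
    then show ?thesis using assms(1) ijk ap by (auto simp: three_free_def nth_append)
  next
    case 2
    then have "i - length us < j - length us" "j - length us < k - length us" "k - length us < length vs"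
      using ijk by auto
    then show ?thesis using assms(2) ap 2 ijk unfolding three_free_def by (auto simp: nth_append)
  next
    case 3
    then have "(us @ vs) ! i \<in> set us" "(us @ vs) ! k \<in> set vs" using ijk by (auto simp: nth_append)
    then show ?thesis using assms(3) ap by fastforce
  qed
qed

lemma three_free_map_even: "three_free xs \<Longrightarrow> three_free (map (\<lambda>x. 2 * x) xs)"
  unfolding three_free_def by fastforce

lemma three_free_map_odd:
  assumes "three_free xs" "0 \<notin> set xs"
  shows "three_free (map (\<lambda>x. 2 * x - 1) xs)"
  unfolding three_free_def
proof clarify
  fix i j k assume ijk: "i < j" "j < k" "k < length (map (\<lambda>x. 2 * x - 1) xs)"
    and ap: "map (\<lambda>x. 2 * x - 1) xs ! i + map (\<lambda>x. 2 * x - 1) xs ! k = 2 * map (\<lambda>x. 2 * x - 1) xs ! j"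
  have "xs ! l \<noteq> 0" if "l < length xs" for l using assms(2) that nth_mem by metis
  then have "xs ! i + xs ! k = 2 * xs ! j" using ijk ap by (fastforce simp: neq0_conv)
  with assms(1) ijk show False by (auto simp: three_free_def)
qed

lemma inj_on_append_pair:
  assumes "inj_on f A" "inj_on g B" "\<And>a. a \<in> A \<Longrightarrow> length (f a) = l"
  shows "inj_on (\<lambda>(a, b). f a @ g b) (A \<times> B)"
proof (rule inj_onI)
  fix p q assume pq: "p \<in> A \<times> B" "q \<in> A \<times> B"
    and eq: "(case p of (a, b) \<Rightarrow> f a @ g b) = (case q of (a, b) \<Rightarrow> f a @ g b)"
  obtain a b a' b' where ab: "p = (a, b)" "q = (a', b')" "a \<in> A" "b \<in> B" "a' \<in> A" "b' \<in> B"
    using pq by blast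
  have "f a = f a' \<and> g b = g b'"
    using eq assms(3)[OF ab(3)] assms(3)[OF ab(5)] by (simp add: ab(1,2))
  then show "p = q" using ab assms(1,2) by (auto dest: inj_onD)
qed

lemma theta_double: "0 < n \<Longrightarrow> 2 * theta n ^ 2 \<le> theta (2 * n)"
proof -
  assume n: "0 < n"
  let ?T = "\<lambda>n. {a \<in> permutations_of_set {1..n}. three_free a}"
  let ?e = "map (\<lambda>x::nat. 2 * x)" and ?o = "map (\<lambda>x::nat. 2 * x - 1)"
  let ?A = "(\<lambda>(s, t). ?e s @ ?o t) ` (?T n \<times> ?T n)" and ?B = "(\<lambda>(s, t). ?o s @ ?e t) ` (?T n \<times> ?T n)"
  have T: "distinct a" "set a = {1..n}" "length a = n" "three_free a" "a \<noteq> []" if "a \<in> ?T n" for a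
    using that n distinct_card[of a] by (auto simp: permutations_of_set_def)
  have e: "distinct (?e a)" "set (?e a) = {x \<in> {1..2 * n}. even x}" "three_free (?e a)" if "a \<in> ?T n" for a
    using T[OF that] by (auto simp: distinct_map inj_on_def three_free_map_even image_iff elim!: evenE)
  have o: "distinct (?o a)" "set (?o a) = {x \<in> {1..2 * n}. odd x}" "three_free (?o a)" if "a \<in> ?T n" for a
  proof -
    note a = T[OF that]
    show "distinct (?o a)" using a by (auto simp: distinct_map inj_on_def)
    show "three_free (?o a)" using a by (intro three_free_map_odd) auto
    show "set (?o a) = {x \<in> {1..2 * n}. odd x}"
    proof (intro set_eqI iffI)
      fix x assume "x \<in> {x \<in> {1..2 * n}. odd x}"
      then show "x \<in> set (?o a)" using a(2) by (cases x rule: nat_halves_cases) auto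
    qed (use a(2) in auto)
  qed
  have sub: "?A \<union> ?B \<subseteq> ?T (2 * n)"
    using e o by (auto simp: permutations_of_set_def intro!: three_free_append)
  have inj_e: "inj_on ?e (?T n)"
    by (rule inj_on_subset[OF _ subset_UNIV]) (simp add: inj_def)
  have inj_o: "inj_on ?o (?T n)"
  proof (rule inj_onI)
    fix a b assume ab: "?o a = ?o b" "a \<in> ?T n" "b \<in> ?T n"
    show "a = b"
      using T(2)[OF ab(2)] T(2)[OF ab(3)] by (intro map_inj_on[OF ab(1)]) (auto simp: inj_on_def)
  qed
  have "inj_on (\<lambda>(s, t). ?e s @ ?o t) (?T n \<times> ?T n)"
    by (rule inj_on_append_pair[OF inj_e inj_o, of n]) (use T(3) in simp)
  then have A: "card ?A = theta n ^ 2"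
    by (simp add: card_image card_cartesian_product theta_def power2_eq_square)
  have "inj_on (\<lambda>(s, t). ?o s @ ?e t) (?T n \<times> ?T n)"
    by (rule inj_on_append_pair[OF inj_o inj_e, of n]) (use T(3) in simp)
  then have B: "card ?B = theta n ^ 2"
    by (simp add: card_image card_cartesian_product theta_def power2_eq_square)
  have fin: "finite (?T m)" for m by simp
  \<comment> \<open>The two families are told apart by the parity of the first entry.\<close>
  have "even (hd a)" if "a \<in> ?A" for a
    using that T(5) by (auto simp: hd_map)
  moreover have "odd (hd b)" if b: "b \<in> ?B" for b
  proof -
    obtain s t where st: "b = ?o s @ ?e t" "s \<in> ?T n" using b by auto
    have "hd s \<in> {1..n}" using T(2,5)[OF st(2)] hd_in_set by blast
    then show ?thesis using st T(5)[OF st(2)] by (simp add: hd_map)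
  qed
  ultimately have "?A \<inter> ?B = {}" by blast
  then have "card (?A \<union> ?B) = 2 * theta n ^ 2"
    using A B fin by (subst card_Un_disjoint) auto
  moreover have "card (?A \<union> ?B) \<le> theta (2 * n)"
    unfolding theta_def by (rule card_mono[OF fin sub])
  ultimately show ?thesis by simp
qed

theorem theorem3:
  shows "theta 64 = 39911512393313043466768
    \<and> 2.279 \<le> c3 \<and> c3 < 2.280
    \<and> (\<forall>(k::nat) (n::nat). k \<ge> 6 \<and> n = 2 ^ k \<longrightarrow> real (theta n) \<ge> c3 ^ n / 2)"
proof (intro conjI allI impI)
  show "theta 64 = 39911512393313043466768" by (rule theta_64)
  have c3: "c3 = root 64 79823024786626086933536"
    by (simp add: c3_def theta_64)
  \<comment> \<open>By the choice of \<open>c3\<close>, the bound is an equality for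
    \<open>k = 6\<close>.\<close>
  have pow: "c3 ^ 64 = 2 * real (theta 64)"
    unfolding c3_def by (rule real_root_pow_pos2) auto
  have "(2.279::real) ^ 64 \<le> 79823024786626086933536"
    by (simp add: power_divide divide_simps)
  then have "root 64 (2.279 ^ 64) \<le> c3" unfolding c3 by simp
  then show "2.279 \<le> c3" by (simp add: real_root_power_cancel)
  have "(79823024786626086933536::real) < 2.280 ^ 64"
    by (simp add: power_divide divide_simps)
  then have "c3 < root 64 (2.280 ^ 64)" unfolding c3 by simp
  then show "c3 < 2.280" by (simp add: real_root_power_cancel)
  fix k n :: nat assume kn: "k \<ge> 6 \<and> n = 2 ^ k"
  then have "6 \<le> k" by simp
  then have "c3 ^ (2 ^ k) / 2 \<le> real (theta (2 ^ k))"
  proof (induction k rule: dec_induct)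
    case base
    then show ?case using pow by simp
  next
    case (step k)
    have "0 \<le> c3" by (simp add: c3_def)
    \<comment> \<open>The factor 1/2 is what makes the bound reproduce itself under doubling:
      \<open>x = c3 ^ n / 2\<close> turns into \<open>2 * x ^ 2 = c3 ^ (2 * n) / 2\<close>.\<close>
    have "c3 ^ (2 ^ Suc k) / 2 = 2 * (c3 ^ (2 ^ k) / 2) ^ 2"
      by (simp add: power2_eq_square power_mult mult.commute[of 2 "2 ^ k"])
    also have "\<dots> \<le> 2 * real (theta (2 ^ k)) ^ 2"
      using step.IH \<open>0 \<le> c3\<close> by (simp add: power_mono)
    also have "\<dots> \<le> real (theta (2 ^ Suc k))"
    proof -
      have "real (2 * theta (2 ^ k) ^ 2) \<le> real (theta (2 ^ Suc k))"
        using theta_double[of "2 ^ k"] unfolding of_nat_le_iff power_Suc by simp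
      then show ?thesis by simp
    qed
    finally show ?case .
  qed
  then show "real (theta n) \<ge> c3 ^ n / 2" using kn by simp
qed

end
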